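(* Let $a>b>1$ be fixed and consider the majority dynamics process described in the context, with a fixed initial configuration $y_0$ for each $N$. There is a constant $A$ depending only on $a,b$ such that the following holds. Let $h_N\to\infty$ satisfy $h_N=o(\sqrt{\log N})$, suppose that $$\widetilde\Delta_0\ge -h_N\frac{N}{\sqrt{\log N}},$$ and set $T_N=\lceil \exp(Ah_N^2)\rceil$. Then there exist constants $c,C,\xi>0$, depending only on $a,b$, such that, for all sufficiently large $N$, $$\mathbb P\left(R_{T_N+3}=\emptyset\right)\ge 1-2\exp(Ah_N^2)\exp\left(-cN\frac{\exp(-Ch_N^2)}{(1+h_N)^2}\right)-4\exp\left(-(\log N)^2\right)-2N^{-\xi}.$$ In particular, the right-hand side is $1-O(N^{-\xi+o(1)})$.
   Context: Process. Fix constants $a>b>1$ and put $\alpha=a\log N/N$, $\beta=b\log N/N$ ($N$ large enough that $\alpha\le 1$; natural logarithm). Let $V=[N]=\{1,\dots,N\}$. An opinion configuration is $y_t\in\{\pm1\}^V$, with $B_t=\{v:y_t(v)=+1\}$ (blue) and $R_t=\{v:y_t(v)=-1\}$ (red). For each $N$ the initial configuration $y_0$ is fixed; let $\mathcal F_t=\sigma(y_0,G_1,\dots,G_t)$. Conditionally on $\mathcal F_t$, $G_{t+1}$ is a random graph on $V$ in which each pair $\{u,v\}$, $u\ne v$, is an edge independently with probability $\alpha$ if $y_t(u)=y_t(v)$ and $\beta$ otherwise. All vertices update synchronously: $y_{t+1}(v)=+1$ if $v$ has strictly more $G_{t+1}$-neighbors in $B_t$ than in $R_t$, $y_{t+1}(v)=-1$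 if strictly fewer, and $y_{t+1}(v)=y_t(v)$ in case of a tie. The weighted advantage is $\widetilde\Delta_t=b|B_t|-a|R_t|$. All asymptotics are as $N\to\infty$. *)

theory Defs
  imports "HOL-Probability.Probability" "HOL-Library.Landau_Symbols"
begin

text \<open>
  The vertex set is \<open>{1..N}\<close>. An opinion configuration is a function with values \<open>1\<close> (blue) and
  \<open>-1\<close> (red) on \<open>{1..N}\<close>; its values elsewhere are irrelevant. A graph on \<open>{1..N}\<close> is a set of
  two-element subsets of \<open>{1..N}\<close>.
\<close>

type_synonym opinions = "nat \<Rightarrow> int"
type_synonym graph = "nat set set"

definition blue :: "nat \<Rightarrow> opinions \<Rightarrow> nat set" where
  "blue N y = {v \<in> {1..N}. y v = 1}"

definition red :: "nat \<Rightarrow> opinions \<Rightarrow> nat set" where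
  "red N y = {v \<in> {1..N}. y v = - 1}"

definition weighted_advantage :: "real \<Rightarrow> real \<Rightarrow> nat \<Rightarrow> opinions \<Rightarrow> real" where
  "weighted_advantage a b N y = b * real (card (blue N y)) - a * real (card (red N y))"

definition vertex_pairs :: "nat \<Rightarrow> nat set set" where
  "vertex_pairs N = {e. e \<subseteq> {1..N} \<and> card e = 2}"

definition edge_prob :: "real \<Rightarrow> real \<Rightarrow> nat \<Rightarrow> opinions \<Rightarrow> nat set \<Rightarrow> real" where
  "edge_prob a b N y e =
     (if \<forall>u\<in>e. \<forall>v\<in>e. y u = y v then a * ln (real N) / real N else b * ln (real N) / real N)"

text \<open>
  \<^const>\<open>bernoulli_pmf\<close> truncates its parameter to \<open>[0, 1]\<close>, so this is meaningful only when \<open>N\<close> is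
  so large that \<open>a * ln N / N \<le> 1\<close>.
\<close>

definition random_graph :: "real \<Rightarrow> real \<Rightarrow> nat \<Rightarrow> opinions \<Rightarrow> graph pmf" where
  "random_graph a b N y =
     map_pmf (\<lambda>X. {e \<in> vertex_pairs N. X e})
       (Pi_pmf (vertex_pairs N) False (\<lambda>e. bernoulli_pmf (edge_prob a b N y e)))"

definition neighbors :: "graph \<Rightarrow> nat \<Rightarrow> nat set" where
  "neighbors G v = {u. {u, v} \<in> G}"

definition majority_update :: "nat \<Rightarrow> graph \<Rightarrow> opinions \<Rightarrow> opinions" where
  "majority_update N G y v =
     (let nb = card (neighbors G v \<inter> blue N y); nr = card (neighbors G v \<inter> red N y)
      in if nb > nr then 1 else if nb < nr then - 1 else y v)"

text \<open>The configuration \<open>y\<^sub>t\<close> determined by \<open>y\<^sub>0\<close> and the list \<open>[G\<^sub>1, \<dots>, G\<^sub>t]\<close>.\<close>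

definition opinions_after :: "nat \<Rightarrow> opinions \<Rightarrow> graph list \<Rightarrow> opinions" where
  "opinions_after N y0 Gs = fold (majority_update N) Gs y0"

text \<open>
  The joint law of \<open>[G\<^sub>1, \<dots>, G\<^sub>t]\<close> for a deterministic \<open>y\<^sub>0\<close>: given the history up to time \<open>t\<close>,
  the next graph is drawn from \<open>random_graph a b N y\<^sub>t\<close>.
\<close>

primrec graph_history :: "real \<Rightarrow> real \<Rightarrow> nat \<Rightarrow> opinions \<Rightarrow> nat \<Rightarrow> graph list pmf" where
  "graph_history a b N y0 0 = return_pmf []"
| "graph_history a b N y0 (Suc t) =
     bind_pmf (graph_history a b N y0 t)
       (\<lambda>Gs. map_pmf (\<lambda>G. Gs @ [G]) (random_graph a b N (opinions_after N y0 Gs)))"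

end

theory Submission
  imports Defs "HOL-Real_Asymp.Real_Asymp"
begin

text \<open>
  Let \<open>L = ln N\<close>, let \<open>R\<close> be the current number of red vertices and \<open>B = N - R\<close>. The weighted
  advantage is \<open>b N - (a + b) R\<close>, so with \<open>\<eta> = h / \<surd>L\<close> the hypothesis on it reads
  \<open>R \<le> (b + \<eta>) N / (a + b)\<close>. A vertex compares its numbers of blue and red neighbours, which are
  independent binomial variables with means of order at most \<open>L\<close>.

  At the threshold the two colours behave very differently. A blue vertex expects about
  \<open>(a B - b R) L / N \<ge> (a - b) L / 2\<close> more blue than red neighbours, so by a Chernoff bound it
  turns red with probability at most \<open>N\<^sup>-\<^sup>\<xi>\<close>. A red vertex expects at most \<open>\<eta> L = h \<surd>L\<close> more red
  than blue neighbours, a deficit of only \<open>O(h)\<close> standard deviations, so it turns blue with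
  probability at least \<open>r = exp (- O(h\<^sup>2))\<close> (\<open>prob_red_turns_blue_ge\<close>). That lower bound comes from a
  change of measure: raising the probability of the edges to blue vertices by the factor
  \<open>1 + O(\<eta>)\<close> makes turning blue likely, and the squared density of the raised law has mean
  \<open>exp (O(h\<^sup>2))\<close>. Two red vertices share only the edge between them, hence turn blue almost
  independently, and Chebyshev's inequality shows that about the expected number of them does so
  (\<open>prob_few_red_turn_blue\<close>). As long as \<open>R \<ge> \<rho> N\<close>, where \<open>\<rho> = b / (2 (a + b))\<close>, each round thus
  lowers \<open>R\<close> by a multiple of \<open>r N\<close>, and \<open>T = exp (A h\<^sup>2)\<close> rounds bring it below \<open>\<rho> N\<close> if \<open>A\<close> is
  large.

  Below \<open>\<rho> N\<close> every vertex, of either colour, expects a blue majority proportional to \<open>L\<close>, so one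
  more round leaves only \<open>N\<^sup>1\<^sup>-\<^sup>\<xi>\<close> red vertices (\<open>prob_red_not_few_le\<close>). Then red neighbours hardly
  matter, and because \<open>b > 1\<close> a Chernoff bound with a large parameter gives every vertex a
  probability of at most \<open>N\<^sup>-\<^sup>\<theta>\<close> with some \<open>\<theta> > 1\<close> of being red after the next round; a union bound
  removes them all (\<open>prob_any_red_le_of_very_few_red\<close>). The all-blue configuration is absorbing.

  Each round fails with probability at most \<open>N\<^sup>-\<^sup>2\<^sup>\<xi>\<close>, after decreasing \<open>\<xi>\<close>. Since \<open>h\<^sup>2 = o(L)\<close>, both
  \<open>T\<close> and \<open>1 / r\<close> are \<open>N\<^sup>o\<^sup>(\<^sup>1\<^sup>)\<close>, and the failures of all \<open>T + 3\<close> rounds add up to at most \<open>2 N\<^sup>-\<^sup>\<xi>\<close>.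
\<close>

section \<open>Families of independent Bernoulli variables\<close>

lemma prob_Pi_pmf_restrict:
  assumes "finite E" "A \<subseteq> E" and dep: "\<And>X Y. (\<And>e. e \<in> A \<Longrightarrow> X e = Y e) \<Longrightarrow> X \<in> S \<longleftrightarrow> Y \<in> S"
  shows "measure_pmf.prob (Pi_pmf E d p) S = measure_pmf.prob (Pi_pmf A d p) S"
proof -
  have "(\<lambda>f x. if x \<in> A then f x else d) -` S = S"
    using dep[of "\<lambda>x. if x \<in> A then f x else d" f for f] by auto
  then show ?thesis
    by (simp add: Pi_pmf_subset[OF assms(1,2)])
qed

text \<open>
  Splitting the product over \<open>A \<union> B\<close> into a pair turns \<open>S \<inter> T\<close> into a rectangle. The rectangle rule
  for pairs needs countable sides, which intersecting with the supports provides.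
\<close>

lemma prob_Pi_pmf_indep:
  assumes fin: "finite E" and sub: "A \<subseteq> E" "B \<subseteq> E" and disj: "A \<inter> B = {}"
    and S: "\<And>X Y. (\<And>e. e \<in> A \<Longrightarrow> X e = Y e) \<Longrightarrow> X \<in> S \<longleftrightarrow> Y \<in> S"
    and T: "\<And>X Y. (\<And>e. e \<in> B \<Longrightarrow> X e = Y e) \<Longrightarrow> X \<in> T \<longleftrightarrow> Y \<in> T"
  shows "measure_pmf.prob (Pi_pmf E d p) (S \<inter> T) =
         measure_pmf.prob (Pi_pmf E d p) S * measure_pmf.prob (Pi_pmf E d p) T"
proof -
  let ?PA = "Pi_pmf A d p" and ?PB = "Pi_pmf B d p"
  have finA: "finite A" and finB: "finite B"
    using fin sub finite_subset by auto
  let ?h = "\<lambda>(f, g) x. if x \<in> A then f x else g x"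
  have "measure_pmf.prob (Pi_pmf E d p) (S \<inter> T) = measure_pmf.prob (Pi_pmf (A \<union> B) d p) (S \<inter> T)"
  proof (rule prob_Pi_pmf_restrict[OF fin])
    fix X Y :: "'a \<Rightarrow> 'b" assume "\<And>e. e \<in> A \<union> B \<Longrightarrow> X e = Y e"
    then have "X \<in> S \<longleftrightarrow> Y \<in> S" "X \<in> T \<longleftrightarrow> Y \<in> T"
      using S[of X Y] T[of X Y] by blast+
    then show "X \<in> S \<inter> T \<longleftrightarrow> Y \<in> S \<inter> T" by blast
  qed (use sub in auto)
  also have "\<dots> = measure_pmf.prob (pair_pmf ?PA ?PB) (?h -` (S \<inter> T))"
    by (subst Pi_pmf_union[OF finA finB disj]) simp
  also have "?h -` (S \<inter> T) = S \<times> T"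
  proof -
    have "?h (f, g) \<in> S \<longleftrightarrow> f \<in> S" for f g by (rule S) auto
    moreover have "?h (f, g) \<in> T \<longleftrightarrow> g \<in> T" for f g by (rule T) (use disj in auto)
    ultimately show ?thesis by auto
  qed
  also have "measure_pmf.prob (pair_pmf ?PA ?PB) (S \<times> T) =
      measure_pmf.prob (pair_pmf ?PA ?PB) ((S \<inter> set_pmf ?PA) \<times> (T \<inter> set_pmf ?PB))"
    by (subst (1 2) measure_Int_set_pmf[symmetric], rule arg_cong[where f = "measure _"]) auto
  also have "\<dots> = measure_pmf.prob ?PA S * measure_pmf.prob ?PB T"
    by (subst measure_pmf_prob_product) (auto simp: measure_Int_set_pmf)
  also have "measure_pmf.prob ?PA S = measure_pmf.prob (Pi_pmf E d p) S"
    by (rule prob_Pi_pmf_restrict[symmetric]) (fact fin, fact sub, rule S, blast)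
  also have "measure_pmf.prob ?PB T = measure_pmf.prob (Pi_pmf E d p) T"
    by (rule prob_Pi_pmf_restrict[symmetric]) (fact fin, fact sub, rule T, blast)
  finally show ?thesis .
qed

definition bernoulli_product :: "'e set \<Rightarrow> ('e \<Rightarrow> real) \<Rightarrow> ('e \<Rightarrow> bool) pmf" where
  "bernoulli_product E p = Pi_pmf E False (\<lambda>e. bernoulli_pmf (p e))"

lemma finite_set_bernoulli_product:
  "finite E \<Longrightarrow> finite (set_pmf (bernoulli_product E p))"
  unfolding bernoulli_product_def by (simp add: set_Pi_pmf finite_PiE_dflt)

lemma expectation_prod_bernoulli_product:
  fixes f :: "'e \<Rightarrow> bool \<Rightarrow> real"
  assumes "finite E" "\<And>e. e \<in> E \<Longrightarrow> 0 \<le> p e \<and> p e \<le> 1" "\<And>e x. e \<in> E \<Longrightarrow> 0 \<le> f e x"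
  shows "measure_pmf.expectation (bernoulli_product E p) (\<lambda>X. \<Prod>e\<in>E. f e (X e)) =
    (\<Prod>e\<in>E. p e * f e True + (1 - p e) * f e False)"
proof -
  have "measure_pmf.expectation (bernoulli_product E p) (\<lambda>X. \<Prod>e\<in>E. f e (X e)) =
      (\<Prod>e\<in>E. measure_pmf.expectation (bernoulli_pmf (p e)) (f e))"
    unfolding bernoulli_product_def
    by (rule expectation_prod_Pi_pmf) (simp_all add: assms integrable_measure_pmf_finite)
  then show ?thesis using assms(2) by (simp add: algebra_simps)
qed

text \<open>
  The exponential Markov inequality for the difference of the two counts, combined with
  \<open>1 + x \<le> exp x\<close> in each factor. The bound keeps \<open>t\<close> free: a small \<open>t\<close> gives the quadratic bound
  below, while a large fixed \<open>t\<close> is what makes the final union bound over all vertices possible.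
\<close>

lemma prob_plus_count_le_minus_count:
  fixes p :: "'e \<Rightarrow> real"
  assumes fin: "finite E" and sub: "P \<subseteq> E" "M \<subseteq> E" and disj: "P \<inter> M = {}"
    and p: "\<And>e. e \<in> E \<Longrightarrow> 0 \<le> p e \<and> p e \<le> 1" and t: "0 \<le> t"
  shows "measure_pmf.prob (bernoulli_product E p) {X. card {e\<in>P. X e} \<le> card {e\<in>M. X e}}
    \<le> exp (- ((1 - exp (- t)) * sum p P) + (exp t - 1) * sum p M)"
proof -
  let ?D = "bernoulli_product E p"
  \<comment> \<open>A present edge of \<open>P\<close> contributes \<open>exp (- t)\<close> and one of \<open>M\<close> contributes \<open>exp t\<close>, so the product
      of the \<open>f e (X e)\<close> is the exponential of \<open>t\<close> times the difference of the counts.\<close>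
  define g where "g e = (if e \<in> P then exp (- t) else if e \<in> M then exp t else 1)" for e :: 'e
  define f where "f e x = (if x then g e else 1)" for e x
  have g0: "g e > 0" for e by (simp add: g_def)
  have finPM: "finite P" "finite M" using fin sub finite_subset by auto
  have prod_f: "(\<Prod>e\<in>E. f e (X e)) =
      exp (t * (real (card {e\<in>M. X e}) - real (card {e\<in>P. X e})))" for X
  proof -
    have "(\<Prod>e\<in>E. f e (X e)) = (\<Prod>e\<in>E. exp (t * ((if e \<in> M \<and> X e then 1 else 0) - (if e \<in> P \<and> X e then 1 else 0))))"
      using disj by (intro prod.cong) (auto simp: f_def g_def)
    also have "\<dots> = exp (t * ((\<Sum>e\<in>E. if e \<in> M \<and> X e then 1 else 0) - (\<Sum>e\<in>E. if e \<in> P \<and> X e then 1 else 0)))"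
      using fin by (simp flip: exp_sum sum_distrib_left sum_subtractf)
    also have "(\<Sum>e\<in>E. if e \<in> M \<and> X e then 1 else (0::real)) = real (card {e\<in>M. X e})"
      using fin sub by (subst sum.inter_filter[symmetric]) (auto intro!: arg_cong[where f = card])
    also have "(\<Sum>e\<in>E. if e \<in> P \<and> X e then 1 else (0::real)) = real (card {e\<in>P. X e})"
      using fin sub by (subst sum.inter_filter[symmetric]) (auto intro!: arg_cong[where f = card])
    finally show ?thesis .
  qed
  have int: "integrable (measure_pmf ?D) F" for F :: "_ \<Rightarrow> real"
    by (rule integrable_measure_pmf_finite) (rule finite_set_bernoulli_product[OF fin])
  have "measure_pmf.prob ?D {X. card {e\<in>P. X e} \<le> card {e\<in>M. X e}} =
      measure_pmf.expectation ?D (indicator {X. card {e\<in>P. X e} \<le> card {e\<in>M. X e}})"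
    by simp
  also have "\<dots> \<le> measure_pmf.expectation ?D (\<lambda>X. \<Prod>e\<in>E. f e (X e))"
    by (rule integral_mono[OF int int]) (auto simp: prod_f indicator_def t)
  also have "\<dots> = (\<Prod>e\<in>E. p e * f e True + (1 - p e) * f e False)"
    by (rule expectation_prod_bernoulli_product) (use fin p g0 in \<open>auto simp: f_def less_imp_le\<close>)
  also have "\<dots> \<le> (\<Prod>e\<in>E. exp (p e * (g e - 1)))"
  proof (rule prod_mono)
    fix e assume e: "e \<in> E"
    have "1 + p e * (g e - 1) \<le> exp (p e * (g e - 1))" by (rule exp_ge_add_one_self)
    moreover have "p e * f e True + (1 - p e) * f e False = 1 + p e * (g e - 1)"
      by (simp add: f_def algebra_simps)
    moreover have "0 \<le> p e * f e True + (1 - p e) * f e False"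
      using p[OF e] g0[of e] by (simp add: f_def less_imp_le)
    ultimately show "0 \<le> p e * f e True + (1 - p e) * f e False \<and>
         p e * f e True + (1 - p e) * f e False \<le> exp (p e * (g e - 1))"
      by simp
  qed
  also have "\<dots> = exp (\<Sum>e\<in>E. p e * (g e - 1))"
    using fin by (simp add: exp_sum)
  also have "(\<Sum>e\<in>E. p e * (g e - 1)) = (\<Sum>e\<in>P \<union> M. p e * (g e - 1))"
    by (rule sum.mono_neutral_right) (use fin sub in \<open>auto simp: g_def\<close>)
  also have "\<dots> = (\<Sum>e\<in>P. p e * (g e - 1)) + (\<Sum>e\<in>M. p e * (g e - 1))"
    by (rule sum.union_disjoint) (use finPM disj in auto)
  also have "(\<Sum>e\<in>P. p e * (g e - 1)) = (\<Sum>e\<in>P. p e * (exp (- t) - 1))"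
    by (rule sum.cong) (auto simp: g_def)
  also have "\<dots> = - ((1 - exp (- t)) * sum p P)"
    by (subst sum_distrib_right[symmetric]) (simp add: algebra_simps)
  also have "(\<Sum>e\<in>M. p e * (g e - 1)) = (exp t - 1) * sum p M"
    unfolding sum_distrib_left
    by (rule sum.cong) (use disj in \<open>auto simp: g_def algebra_simps\<close>)
  finally show ?thesis .
qed

text \<open>
  The choice \<open>t = m / (2 S) \<le> 1\<close> minimises \<open>- t m + t\<^sup>2 S\<close>, which bounds the exponent above
  because \<open>1 - exp (- t) \<ge> t - t\<^sup>2\<close> and \<open>exp t - 1 \<le> t + t\<^sup>2\<close> on \<open>[0, 1]\<close>.
\<close>

lemma prob_plus_count_le_minus_count_quadratic:
  fixes p :: "'e \<Rightarrow> real"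
  assumes fin: "finite E" and sub: "P \<subseteq> E" "M \<subseteq> E" and disj: "P \<inter> M = {}"
    and p: "\<And>e. e \<in> E \<Longrightarrow> 0 \<le> p e \<and> p e \<le> 1"
    and m: "0 \<le> m" "m \<le> sum p P - sum p M" and S: "0 < S" "sum p P + sum p M \<le> S"
  shows "measure_pmf.prob (bernoulli_product E p) {X. card {e\<in>P. X e} \<le> card {e\<in>M. X e}}
    \<le> exp (- (m\<^sup>2 / (4 * S)))"
proof -
  define t where "t = m / (2 * S)"
  have pos: "0 \<le> sum p P" "0 \<le> sum p M"
    using p sub by (auto intro!: sum_nonneg)
  have t: "0 \<le> t" "t \<le> 1" using m S pos by (auto simp: t_def field_simps)
  have e1: "t - t\<^sup>2 \<le> 1 - exp (- t)"
  proof -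
    have "exp (- t) * (1 + t) \<le> 1"
      using exp_ge_add_one_self[of t] mult_left_mono[of "1 + t" "exp t" "exp (- t)"]
      by (simp add: exp_minus)
    moreover have "(1 - t + t\<^sup>2) * (1 + t) \<ge> 1"
      using t by (simp add: algebra_simps power2_eq_square)
    ultimately have "exp (- t) * (1 + t) \<le> (1 - t + t\<^sup>2) * (1 + t)" by linarith
    then have "exp (- t) \<le> 1 - t + t\<^sup>2" using t by simp
    then show ?thesis by simp
  qed
  have e2: "exp t - 1 \<le> t + t\<^sup>2" using exp_bound[of t] t by simp
  have "- ((1 - exp (- t)) * sum p P) + (exp t - 1) * sum p M
      \<le> - ((t - t\<^sup>2) * sum p P) + (t + t\<^sup>2) * sum p M"
    using mult_right_mono[OF e1 pos(1)] mult_right_mono[OF e2 pos(2)] by linarith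
  also have "\<dots> = - (t * (sum p P - sum p M)) + t\<^sup>2 * (sum p P + sum p M)"
    by (simp add: algebra_simps)
  also have "\<dots> \<le> - (t * m) + t\<^sup>2 * S"
    using mult_left_mono[OF m(2) t(1)] mult_left_mono[OF S(2), of "t\<^sup>2"] by simp
  also have "\<dots> = - (m\<^sup>2 / (4 * S))"
    using S by (simp add: t_def field_simps power2_eq_square)
  finally show ?thesis
    using prob_plus_count_le_minus_count[OF fin sub disj p t(1)] by (meson exp_le_cancel_iff order.trans)
qed

text \<open>
  Cauchy-Schwarz applied to the density \<open>L\<close> of the law with parameters \<open>q\<close> relative to the one with
  parameters \<open>p\<close>: \<open>Q(S)\<^sup>2 = (E\<^sub>P[1\<^sub>S L])\<^sup>2 \<le> P(S) E\<^sub>P[L\<^sup>2]\<close>. The second moment of \<open>L\<close> factorises, and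
  each factor is one plus the chi-square divergence of the two Bernoulli laws. So an event that is
  likely under \<open>q\<close> cannot be too rare under \<open>p\<close>; this is how lower bounds for large deviations arise
  here.
\<close>

lemma bernoulli_product_change_of_measure:
  fixes p q :: "'e \<Rightarrow> real"
  assumes fin: "finite E" and p: "\<And>e. e \<in> E \<Longrightarrow> 0 < p e \<and> p e < 1"
    and q: "\<And>e. e \<in> E \<Longrightarrow> 0 \<le> q e \<and> q e \<le> 1"
  shows "(measure_pmf.prob (bernoulli_product E q) S)\<^sup>2 \<le>
    measure_pmf.prob (bernoulli_product E p) S * exp (\<Sum>e\<in>E. (q e - p e)\<^sup>2 / (p e * (1 - p e)))"
proof -
  let ?P = "bernoulli_product E p" and ?Q = "bernoulli_product E q"
  define W where "W = PiE_dflt E False (\<lambda>_. UNIV :: bool set)"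
  have finW: "finite W" unfolding W_def using fin by auto
  have supp: "set_pmf (bernoulli_product E r) \<subseteq> W" for r :: "'e \<Rightarrow> real"
    unfolding W_def bernoulli_product_def using set_Pi_pmf_subset'[OF fin]
    by (force simp: PiE_dflt_def)
  define ratio where "ratio e x = (if x then q e / p e else (1 - q e) / (1 - p e))" for e x
  define L where "L X = (\<Prod>e\<in>E. ratio e (X e))" for X
  have dens: "pmf ?Q X = L X * pmf ?P X" if "X \<in> W" for X
  proof -
    have dflt: "X e = False" if "e \<notin> E" for e using \<open>X \<in> W\<close> that by (auto simp: W_def PiE_dflt_def)
    have "pmf (bernoulli_pmf (q e)) (X e) = ratio e (X e) * pmf (bernoulli_pmf (p e)) (X e)" if "e \<in> E" for e
      using p[OF that] q[OF that] by (cases "X e") (auto simp: ratio_def)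
    then show ?thesis
      unfolding bernoulli_product_def L_def
      by (subst (1 2) pmf_Pi'[OF fin dflt]) (auto simp: prod.distrib[symmetric] intro!: prod.cong)
  qed
  have prob_sum: "measure_pmf.prob (bernoulli_product E r) S = (\<Sum>X\<in>S \<inter> W. pmf (bernoulli_product E r) X)"
    for r :: "'e \<Rightarrow> real"
  proof -
    have "measure_pmf.prob (bernoulli_product E r) S = measure_pmf.prob (bernoulli_product E r) (S \<inter> W)"
      using supp[of r] by (intro measure_eq_AE) (auto simp: AE_measure_pmf_iff)
    also have "\<dots> = (\<Sum>X\<in>S \<inter> W. pmf (bernoulli_product E r) X)"
      using finW by (subst measure_measure_pmf_finite) auto
    finally show ?thesis .
  qed
  have "(measure_pmf.prob ?Q S)\<^sup>2 = (\<Sum>X\<in>S \<inter> W. sqrt (pmf ?P X) * (L X * sqrt (pmf ?P X)))\<^sup>2"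
    unfolding prob_sum
    by (intro arg_cong[where f = "\<lambda>x. x\<^sup>2"] sum.cong)
       (auto simp: dens algebra_simps simp flip: real_sqrt_mult)
  also have "\<dots> \<le> (\<Sum>X\<in>S \<inter> W. (sqrt (pmf ?P X))\<^sup>2) * (\<Sum>X\<in>S \<inter> W. (L X * sqrt (pmf ?P X))\<^sup>2)"
    by (rule Cauchy_Schwarz_ineq_sum)
  also have "(\<Sum>X\<in>S \<inter> W. (sqrt (pmf ?P X))\<^sup>2) = measure_pmf.prob ?P S"
    unfolding prob_sum by simp
  also have "(\<Sum>X\<in>S \<inter> W. (L X * sqrt (pmf ?P X))\<^sup>2) \<le> (\<Sum>X\<in>W. (L X * sqrt (pmf ?P X))\<^sup>2)"
    by (rule sum_mono2) (use finW in auto)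
  also have "\<dots> = (\<Sum>X\<in>W. (\<Prod>e\<in>E. (ratio e (X e))\<^sup>2) * pmf ?P X)"
    by (intro sum.cong) (auto simp: power_mult_distrib L_def prod_power_distrib)
  also have "\<dots> = measure_pmf.expectation ?P (\<lambda>X. \<Prod>e\<in>E. (ratio e (X e))\<^sup>2)"
    by (rule integral_measure_pmf_real[symmetric, OF finW]) (use supp[of p] in auto)
  also have "\<dots> = (\<Prod>e\<in>E. p e * (ratio e True)\<^sup>2 + (1 - p e) * (ratio e False)\<^sup>2)"
    by (rule expectation_prod_bernoulli_product) (use fin p in \<open>auto simp: less_imp_le\<close>)
  also have "\<dots> \<le> (\<Prod>e\<in>E. exp ((q e - p e)\<^sup>2 / (p e * (1 - p e))))"
  proof (rule prod_mono)
    fix e assume e: "e \<in> E"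
    have "p e * (ratio e True)\<^sup>2 + (1 - p e) * (ratio e False)\<^sup>2 = 1 + (q e - p e)\<^sup>2 / (p e * (1 - p e))"
      using p[OF e] unfolding ratio_def
      by (simp add: divide_simps power2_eq_square) (simp add: algebra_simps)
    then show "0 \<le> p e * (ratio e True)\<^sup>2 + (1 - p e) * (ratio e False)\<^sup>2 \<and>
        p e * (ratio e True)\<^sup>2 + (1 - p e) * (ratio e False)\<^sup>2 \<le> exp ((q e - p e)\<^sup>2 / (p e * (1 - p e)))"
      using p[OF e] exp_ge_add_one_self[of "(q e - p e)\<^sup>2 / (p e * (1 - p e))"] by simp
  qed
  also have "\<dots> = exp (\<Sum>e\<in>E. (q e - p e)\<^sup>2 / (p e * (1 - p e)))"
    using fin by (simp add: exp_sum)
  finally show ?thesis by (simp add: mult_left_mono)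
qed

text \<open>
  Chebyshev's inequality: nearly uncorrelated events, in the sense of the bound \<open>\<gamma>\<close>, give the count a
  variance of at most \<open>\<gamma> n\<^sup>2 + n\<close>, where \<open>n = card V\<close>, while its mean is at least \<open>r n\<close>.
\<close>

lemma prob_count_le_half_mean:
  fixes D :: "'x pmf" and F :: "'v \<Rightarrow> 'x set"
  assumes finV: "finite V" and ne: "V \<noteq> {}" and finD: "finite (set_pmf D)"
    and r: "0 < r" "\<And>v. v \<in> V \<Longrightarrow> r \<le> measure_pmf.prob D (F v)"
    and cov: "\<And>u v. u \<in> V \<Longrightarrow> v \<in> V \<Longrightarrow> u \<noteq> v \<Longrightarrow>
      measure_pmf.prob D (F u \<inter> F v) \<le> measure_pmf.prob D (F u) * measure_pmf.prob D (F v) + \<gamma>"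
    and \<gamma>: "0 \<le> \<gamma>"
  shows "measure_pmf.prob D {X. real (card {v\<in>V. X \<in> F v}) \<le> r * real (card V) / 2}
    \<le> 4 / (r\<^sup>2 * real (card V)) + 4 * \<gamma> / r\<^sup>2"
proof -
  let ?n = "real (card V)"
  have n: "?n > 0" using finV ne by (simp add: card_gt_0_iff)
  define Z where "Z X = (\<Sum>v\<in>V. indicat_real (F v) X)" for X
  have Z: "real (card {v\<in>V. X \<in> F v}) = Z X" for X
    using finV by (simp add: Z_def indicator_def sum.If_cases Int_def)
  have int: "integrable (measure_pmf D) f" for f :: "_ \<Rightarrow> real"
    by (rule integrable_measure_pmf_finite[OF finD])
  define \<mu> where "\<mu> = measure_pmf.expectation D Z"
  have \<mu>: "\<mu> = (\<Sum>v\<in>V. measure_pmf.prob D (F v))"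
    unfolding \<mu>_def Z_def by (subst Bochner_Integration.integral_sum) (auto simp: int)
  have \<mu>_ge: "r * ?n \<le> \<mu>" unfolding \<mu> using sum_mono[OF r(2), of V "\<lambda>v. v"] by (simp add: mult.commute)
  have "measure_pmf.expectation D (\<lambda>X. (Z X)\<^sup>2) =
      (\<Sum>u\<in>V. \<Sum>v\<in>V. measure_pmf.prob D (F u \<inter> F v))"
  proof -
    have "(Z X)\<^sup>2 = (\<Sum>u\<in>V. \<Sum>v\<in>V. indicat_real (F u \<inter> F v) X)" for X
      unfolding Z_def power2_eq_square sum_product by (simp add: indicator_inter_arith)
    then show ?thesis
      by (simp only:) (subst Bochner_Integration.integral_sum; simp add: int)
  qed
  also have "\<dots> \<le> (\<Sum>u\<in>V. \<Sum>v\<in>V. measure_pmf.prob D (F u) * measure_pmf.prob D (F v) + \<gamma>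
      + (if v = u then 1 else 0))"
  proof (intro sum_mono)
    fix u v assume uv: "u \<in> V" "v \<in> V"
    show "measure_pmf.prob D (F u \<inter> F v) \<le> measure_pmf.prob D (F u) * measure_pmf.prob D (F v) + \<gamma>
      + (if v = u then 1 else 0)"
      using cov[OF uv] \<gamma> measure_pmf.prob_le_1[of D "F u \<inter> F v"]
      by (auto intro!: order.trans[OF measure_pmf.prob_le_1] add_nonneg_nonneg)
  qed
  also have "\<dots> = \<mu>\<^sup>2 + \<gamma> * ?n\<^sup>2 + ?n"
    using finV by (simp add: sum.distrib \<mu> power2_eq_square sum_product)
  finally have var: "measure_pmf.variance D Z \<le> \<gamma> * ?n\<^sup>2 + ?n"
    using int by (subst measure_pmf.variance_eq) (auto simp: \<mu>_def)
  have pos: "0 < r * ?n / 2" using r n by simp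
  have "measure_pmf.prob D {X. real (card {v\<in>V. X \<in> F v}) \<le> r * ?n / 2}
      \<le> measure_pmf.prob D {X \<in> space D. r * ?n / 2 \<le> \<bar>Z X - measure_pmf.expectation D Z\<bar>}"
    unfolding Z using \<mu>_ge by (intro measure_pmf.finite_measure_mono) (auto simp: \<mu>_def[symmetric] abs_if)
  also have "\<dots> \<le> measure_pmf.variance D Z / (r * ?n / 2)\<^sup>2"
    by (rule measure_pmf.Chebyshev_inequality) (use int pos in auto)
  also have "\<dots> \<le> (\<gamma> * ?n\<^sup>2 + ?n) / (r * ?n / 2)\<^sup>2"
    by (rule divide_right_mono[OF var]) simp
  also have "\<dots> = 4 / (r\<^sup>2 * ?n) + 4 * \<gamma> / r\<^sup>2"
    using r n by (simp add: field_simps power2_eq_square)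
  finally show ?thesis .
qed

lemma prob_count_ge_Markov:
  fixes D :: "'x pmf" and F :: "'v \<Rightarrow> 'x set"
  assumes finV: "finite V" and finD: "finite (set_pmf D)" and c: "0 < c"
    and \<epsilon>: "\<And>v. v \<in> V \<Longrightarrow> measure_pmf.prob D (F v) \<le> \<epsilon>"
  shows "measure_pmf.prob D {X. c \<le> real (card {v\<in>V. X \<in> F v})} \<le> real (card V) * \<epsilon> / c"
proof -
  define Z where "Z X = (\<Sum>v\<in>V. indicat_real (F v) X)" for X
  have Z: "real (card {v\<in>V. X \<in> F v}) = Z X" for X
    using finV by (simp add: Z_def indicator_def sum.If_cases Int_def)
  have int: "integrable (measure_pmf D) f" for f :: "_ \<Rightarrow> real"
    by (rule integrable_measure_pmf_finite[OF finD])
  have "measure_pmf.prob D {X \<in> space D. Z X \<ge> c} \<le> measure_pmf.expectation D Z / c"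
    by (rule integral_Markov_inequality_measure[where A = "{}"])
       (use int c in \<open>auto simp: Z_def sum_nonneg\<close>)
  also have "measure_pmf.expectation D Z = (\<Sum>v\<in>V. measure_pmf.prob D (F v))"
    unfolding Z_def by (subst Bochner_Integration.integral_sum) (auto simp: int)
  also have "\<dots> \<le> real (card V) * \<epsilon>"
    using sum_bounded_above[of V, OF \<epsilon>] by simp
  finally show ?thesis using c by (simp add: Z divide_right_mono)
qed

section \<open>Neighbours in the random graph\<close>

lemma finite_vertex_pairs [simp]: "finite (vertex_pairs N)"
  by (rule finite_subset[of _ "Pow {1..N}"]) (auto simp: vertex_pairs_def)

text \<open>
  The possible edges from \<open>v\<close> to \<open>S\<close>. All counts of neighbours are counts of present edges in such
  stars, and disjoint stars are independent.
\<close>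

definition star :: "nat \<Rightarrow> nat set \<Rightarrow> nat set set" where
  "star v S = (\<lambda>u. {u, v}) ` (S - {v})"

lemma star_subset: "S \<subseteq> {1..N} \<Longrightarrow> v \<in> {1..N} \<Longrightarrow> star v S \<subseteq> vertex_pairs N"
  by (auto simp: star_def vertex_pairs_def card_insert_if)

lemma card_star: "card (star v S) = card (S - {v})"
  unfolding star_def by (rule card_image) (auto simp: inj_on_def doubleton_eq_iff)

lemma star_disjoint: "S \<inter> T = {} \<Longrightarrow> star v S \<inter> star v T = {}"
  by (auto simp: star_def doubleton_eq_iff)

lemma star_Un: "star v (S \<union> T) = star v S \<union> star v T"
  by (auto simp: star_def)

lemma star_mono: "S \<subseteq> T \<Longrightarrow> star v S \<subseteq> star v T"
  by (auto simp: star_def)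

lemma finite_star [simp]: "finite S \<Longrightarrow> finite (star v S)"
  by (simp add: star_def)

lemma card_neighbors_eq_card_star:
  assumes "S \<subseteq> {1..N}" "v \<in> {1..N}"
  shows "card (neighbors {e \<in> vertex_pairs N. X e} v \<inter> S) = card {e \<in> star v S. X e}"
proof -
  have "{u, v} \<in> vertex_pairs N \<longleftrightarrow> u \<noteq> v" if "u \<in> S" for u
    using that assms by (auto simp: vertex_pairs_def card_insert_if)
  then have "neighbors {e \<in> vertex_pairs N. X e} v \<inter> S = {u \<in> S - {v}. X {u, v}}"
    by (auto simp: neighbors_def)
  then have "{e \<in> star v S. X e} = (\<lambda>u. {u, v}) ` (neighbors {e \<in> vertex_pairs N. X e} v \<inter> S)"
    by (auto simp: star_def)
  moreover have "inj_on (\<lambda>u. {u, v}) A" for A :: "nat set"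
    by (auto simp: inj_on_def doubleton_eq_iff)
  ultimately show ?thesis by (simp add: card_image)
qed

lemma random_graph_eq:
  "random_graph a b N y =
    map_pmf (\<lambda>X. {e \<in> vertex_pairs N. X e}) (bernoulli_product (vertex_pairs N) (edge_prob a b N y))"
  by (simp add: random_graph_def bernoulli_product_def)

lemma prob_random_graph:
  "measure_pmf.prob (random_graph a b N y) {G. Q G} =
   measure_pmf.prob (bernoulli_product (vertex_pairs N) (edge_prob a b N y))
     {X. Q {e \<in> vertex_pairs N. X e}}"
  by (simp add: random_graph_eq vimage_def)

lemma finite_set_random_graph: "finite (set_pmf (random_graph a b N y))"
  by (simp add: random_graph_eq finite_set_bernoulli_product)

text \<open>
  One round from a fixed configuration \<open>y\<close>. The bound \<open>1 / 2\<close> on the larger edge probability keeps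
  \<^const>\<open>bernoulli_pmf\<close> away from truncation and leaves room for raising the smaller one by a factor
  up to \<open>2\<close>.
\<close>

locale majority_step =
  fixes a b :: real and N :: nat and y :: opinions
  assumes b1: "1 < b" and ba: "b < a" and N2: "2 \<le> N"
    and small: "a * ln (real N) / real N \<le> 1 / 2"
    and valid: "\<And>v. v \<in> {1..N} \<Longrightarrow> y v = 1 \<or> y v = - 1"
begin

definition L where "L = ln (real N)"
definition \<alpha> where "\<alpha> = a * L / real N"
definition \<beta> where "\<beta> = b * L / real N"
abbreviation B where "B \<equiv> blue N y"
abbreviation R where "R \<equiv> red N y"
abbreviation D where "D \<equiv> random_graph a b N y"
abbreviation nB where "nB \<equiv> real (card (blue N y))"
abbreviation nR where "nR \<equiv> real (card (red N y))"
abbreviation upd where "upd G \<equiv> majority_update N G y"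

lemma L_pos: "0 < L" using N2 by (simp add: L_def)

lemma \<alpha>\<beta>: "0 < \<beta>" "\<beta> < \<alpha>" "\<alpha> \<le> 1 / 2" "real N * \<alpha> = a * L" "real N * \<beta> = b * L"
  using L_pos b1 ba N2 small
  by (auto simp: \<alpha>_def \<beta>_def L_def[symmetric] divide_strict_right_mono)

lemma BR: "B \<subseteq> {1..N}" "R \<subseteq> {1..N}" "B \<inter> R = {}" "B \<union> R = {1..N}" "finite B" "finite R"
proof -
  show "B \<union> R = {1..N}" unfolding blue_def red_def using valid by blast
qed (auto simp: blue_def red_def)

lemma nBR: "nB + nR = real N"
  using card_Un_disjoint[OF BR(5,6,3)] BR(4) by simp

lemma edge_prob_bounds: "0 < edge_prob a b N y e" "edge_prob a b N y e \<le> 1 / 2"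
proof -
  have "edge_prob a b N y e = \<alpha> \<or> edge_prob a b N y e = \<beta>"
    by (simp add: edge_prob_def \<alpha>_def \<beta>_def L_def)
  then show "0 < edge_prob a b N y e" "edge_prob a b N y e \<le> 1 / 2"
    using \<alpha>\<beta>(1-3) by auto
qed

lemma edge_prob_star:
  assumes "v \<in> {1..N}"
  shows "e \<in> star v B \<Longrightarrow> edge_prob a b N y e = (if y v = 1 then \<alpha> else \<beta>)"
    and "e \<in> star v R \<Longrightarrow> edge_prob a b N y e = (if y v = 1 then \<beta> else \<alpha>)"
proof -
  have pair: "edge_prob a b N y {u, v} = (if y u = y v then \<alpha> else \<beta>)" for u
    by (auto simp: edge_prob_def \<alpha>_def \<beta>_def L_def)
  have yv: "y v = 1 \<or> y v = - 1" by (rule valid[OF assms])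
  show "edge_prob a b N y e = (if y v = 1 then \<alpha> else \<beta>)" if e: "e \<in> star v B"
  proof -
    obtain u where "e = {u, v}" "y u = 1" using e by (auto simp: star_def blue_def)
    then show ?thesis using pair[of u] yv by auto
  qed
  show "edge_prob a b N y e = (if y v = 1 then \<beta> else \<alpha>)" if e: "e \<in> star v R"
  proof -
    obtain u where "e = {u, v}" "y u = - 1" using e by (auto simp: star_def red_def)
    then show ?thesis using pair[of u] yv by auto
  qed
qed

lemma sum_edge_prob_star:
  assumes "v \<in> {1..N}"
  shows "sum (edge_prob a b N y) (star v B) = real (card (B - {v})) * (if y v = 1 then \<alpha> else \<beta>)"
    and "sum (edge_prob a b N y) (star v R) = real (card (R - {v})) * (if y v = 1 then \<beta> else \<alpha>)"
proof -
  have "sum (edge_prob a b N y) (star v B) = (\<Sum>e\<in>star v B. if y v = 1 then \<alpha> else \<beta>)"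
    by (rule sum.cong[OF refl]) (rule edge_prob_star(1)[OF assms])
  then show "sum (edge_prob a b N y) (star v B) = real (card (B - {v})) * (if y v = 1 then \<alpha> else \<beta>)"
    by (simp only: sum_constant card_star)
  have "sum (edge_prob a b N y) (star v R) = (\<Sum>e\<in>star v R. if y v = 1 then \<beta> else \<alpha>)"
    by (rule sum.cong[OF refl]) (rule edge_prob_star(2)[OF assms])
  then show "sum (edge_prob a b N y) (star v R) = real (card (R - {v})) * (if y v = 1 then \<beta> else \<alpha>)"
    by (simp only: sum_constant card_star)
qed

lemma card_remove_vertex:
  "y v = 1 \<Longrightarrow> v \<in> {1..N} \<Longrightarrow> real (card (B - {v})) = nB - 1 \<and> card (R - {v}) = card R"
  "y v = - 1 \<Longrightarrow> v \<in> {1..N} \<Longrightarrow> real (card (R - {v})) = nR - 1 \<and> card (B - {v}) = card B"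
proof -
  assume v: "y v = 1" "v \<in> {1..N}"
  then have "v \<in> B" "R - {v} = R" by (auto simp: blue_def red_def)
  then show "real (card (B - {v})) = nB - 1 \<and> card (R - {v}) = card R"
    using card_Suc_Diff1[OF BR(5)] by (metis add.commute add_diff_cancel_left' of_nat_Suc)
next
  assume v: "y v = - 1" "v \<in> {1..N}"
  then have "v \<in> R" "B - {v} = B" by (auto simp: blue_def red_def)
  then show "real (card (R - {v})) = nR - 1 \<and> card (B - {v}) = card B"
    using card_Suc_Diff1[OF BR(6)] by (metis add.commute add_diff_cancel_left' of_nat_Suc)
qed

lemma upd_star:
  assumes "v \<in> {1..N}"
  defines "nb \<equiv> \<lambda>X. card {e \<in> star v B. X e}" and "nr \<equiv> \<lambda>X. card {e \<in> star v R. X e}"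
  shows "upd {e \<in> vertex_pairs N. X e} v =
    (if nb X > nr X then 1 else if nb X < nr X then - 1 else y v)"
  using assms BR by (simp add: majority_update_def card_neighbors_eq_card_star Let_def)

lemma upd_valid: "v \<in> {1..N} \<Longrightarrow> upd G v = 1 \<or> upd G v = - 1"
  using valid by (auto simp: majority_update_def Let_def)

text \<open>
  A tie leaves the colour unchanged, so a vertex of either colour can be red afterwards only if it
  has at least as many red as blue neighbours. This weak inequality treats both colours at once.
\<close>

lemma prob_upd_red_le:
  assumes v: "v \<in> {1..N}"
  shows "measure_pmf.prob D {G. upd G v = - 1} \<le>
    measure_pmf.prob (bernoulli_product (vertex_pairs N) (edge_prob a b N y))
      {X. card {e \<in> star v B. X e} \<le> card {e \<in> star v R. X e}}"
  unfolding prob_random_graph upd_star[OF v]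
  by (rule measure_pmf.finite_measure_mono) auto

lemma edge_prob01: "0 \<le> edge_prob a b N y e \<and> edge_prob a b N y e \<le> 1"
  using edge_prob_bounds[of e] by simp

lemmas star_facts = finite_vertex_pairs star_subset[OF BR(1)] star_subset[OF BR(2)]

text \<open>
  The bounds use the smaller edge probability \<open>\<beta>\<close> for blue and the larger one \<open>\<alpha>\<close> for red
  neighbours, and \<open>nB - 1\<close> in case \<open>v\<close> is itself blue, so that they hold for both colours.
\<close>

lemma prob_upd_red_exp:
  assumes v: "v \<in> {1..N}" and t: "0 \<le> t"
  shows "measure_pmf.prob D {G. upd G v = - 1} \<le>
    exp (- ((1 - exp (- t)) * (\<beta> * (nB - 1))) + (exp t - 1) * (\<alpha> * nR))"
proof -
  have "measure_pmf.prob D {G. upd G v = - 1} \<le> exp (- ((1 - exp (- t)) * sum (edge_prob a b N y) (star v B))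
      + (exp t - 1) * sum (edge_prob a b N y) (star v R))"
    using prob_upd_red_le[OF v] prob_plus_count_le_minus_count[OF star_facts(1) star_facts(2)[OF v] star_facts(3)[OF v]
        star_disjoint[OF BR(3)] edge_prob01 t]
    by (rule order.trans)
  also have "\<dots> \<le> exp (- ((1 - exp (- t)) * (\<beta> * (nB - 1))) + (exp t - 1) * (\<alpha> * nR))"
  proof -
    have cB: "nB - 1 \<le> real (card (B - {v}))" and cR: "real (card (R - {v})) \<le> nR"
      using card_remove_vertex[OF _ v] valid[OF v] by (auto split: if_splits)
    have "\<beta> * (nB - 1) \<le> \<beta> * real (card (B - {v}))"
      using cB \<alpha>\<beta> by simp
    also have "\<dots> \<le> sum (edge_prob a b N y) (star v B)"
      unfolding sum_edge_prob_star[OF v]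
      using \<alpha>\<beta> mult_right_mono[of \<beta> \<alpha> "real (card (B - {v}))"] by (simp add: mult.commute)
    finally have 1: "\<beta> * (nB - 1) \<le> sum (edge_prob a b N y) (star v B)" .
    have "sum (edge_prob a b N y) (star v R) \<le> \<alpha> * real (card (R - {v}))"
      unfolding sum_edge_prob_star[OF v]
      using \<alpha>\<beta> mult_right_mono[of \<beta> \<alpha> "real (card (R - {v}))"] by (simp add: mult.commute)
    also have "\<dots> \<le> \<alpha> * nR" using cR \<alpha>\<beta> by simp
    finally have 2: "sum (edge_prob a b N y) (star v R) \<le> \<alpha> * nR" .
    have "0 \<le> 1 - exp (- t)" "0 \<le> exp t - 1" using t by auto
    from mult_left_mono[OF 1 this(1)] mult_left_mono[OF 2 this(2)] show ?thesis by simp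
  qed
  finally show ?thesis .
qed

lemma prob_upd_red_quadratic:
  assumes v: "v \<in> {1..N}" and m0: "0 \<le> m"
    and m: "y v = 1 \<Longrightarrow> m \<le> \<alpha> * (nB - 1) - \<beta> * nR" "y v = - 1 \<Longrightarrow> m \<le> \<beta> * nB - \<alpha> * (nR - 1)"
  shows "measure_pmf.prob D {G. upd G v = - 1} \<le> exp (- (m\<^sup>2 / (4 * (a * L))))"
proof -
  let ?p = "edge_prob a b N y"
  have m': "m \<le> sum ?p (star v B) - sum ?p (star v R)"
    unfolding sum_edge_prob_star[OF v]
    using m card_remove_vertex[OF _ v] valid[OF v] by (auto simp: mult.commute)
  have S: "sum ?p (star v B) + sum ?p (star v R) \<le> a * L"
  proof -
    have "sum ?p (star v B) + sum ?p (star v R) \<le> nB * \<alpha> + nR * \<alpha>"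
      unfolding sum_edge_prob_star[OF v] using \<alpha>\<beta> BR
      by (intro add_mono mult_mono) (auto intro!: card_mono)
    also have "\<dots> = a * L" using nBR \<alpha>\<beta>(4) by (simp flip: distrib_right)
    finally show ?thesis .
  qed
  have "0 < a * L" using L_pos ba b1 by simp
  from prob_plus_count_le_minus_count_quadratic[OF star_facts(1) star_facts(2)[OF v] star_facts(3)[OF v]
        star_disjoint[OF BR(3)] edge_prob01 m0 m' this S] prob_upd_red_le[OF v]
  show ?thesis by (meson order.trans)
qed

text \<open>
  If raising the probability of the edges to blue vertices from \<open>\<beta>\<close> to \<open>\<beta> (1 + s)\<close> gives \<open>v\<close> an
  expected blue majority of at least \<open>m\<close>, and \<open>m\<close> is large enough in the sense of \<open>half\<close>, then \<open>v\<close>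
  turns blue with probability at least \<open>1 / 2\<close> under the raised law. Each of the at most \<open>N\<close> raised edges contributes at most \<open>2 \<beta> s\<^sup>2\<close> to the chi-square exponent,
  in total \<open>2 b L s\<^sup>2\<close>.
\<close>

lemma prob_red_turns_blue_ge:
  assumes v: "v \<in> {1..N}" "y v = - 1" and s: "0 \<le> s" "s \<le> 1" and m0: "0 \<le> m"
    and m: "m \<le> \<beta> * (1 + s) * nB - \<alpha> * nR"
    and half: "exp (- (m\<^sup>2 / (4 * ((2 * b + a) * L)))) \<le> 1 / 2"
  shows "exp (- (2 * b * L * s\<^sup>2)) / 4 \<le> measure_pmf.prob D {G. upd G v = 1}"
proof -
  let ?p = "edge_prob a b N y" and ?E = "vertex_pairs N"
  define q where "q e = (if e \<in> star v B then \<beta> * (1 + s) else ?p e)" for e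
  define F where "F = {X. card {e \<in> star v R. X e} < card {e \<in> star v B. X e}}"
  have q01: "0 \<le> q e \<and> q e \<le> 1" for e
  proof -
    have "\<beta> * (1 + s) \<le> 1 / 2 * 2" using \<alpha>\<beta> s by (intro mult_mono) auto
    then show ?thesis using \<alpha>\<beta> s edge_prob01[of e] by (auto simp: q_def)
  qed
  have disj: "star v B \<inter> star v R = {}" by (rule star_disjoint[OF BR(3)])
  have cards: "real (card (R - {v})) = nR - 1" "card (B - {v}) = card B"
    using card_remove_vertex(2)[OF v(2,1)] by auto
  have qB: "sum q (star v B) = \<beta> * (1 + s) * nB"
    by (simp add: q_def card_star cards)
  have "sum q (star v R) = sum ?p (star v R)"
    by (rule sum.cong) (use disj in \<open>auto simp: q_def\<close>)
  then have qR: "sum q (star v R) = \<alpha> * (nR - 1)"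
    using sum_edge_prob_star(2)[OF v(1)] v(2) cards by (simp add: mult.commute)
  have m': "m \<le> sum q (star v B) - sum q (star v R)"
    unfolding qB qR using m \<alpha>\<beta> by (simp add: algebra_simps)
  have S: "sum q (star v B) + sum q (star v R) \<le> (2 * b + a) * L"
  proof -
    have "\<beta> * (1 + s) * nB \<le> \<beta> * 2 * real N" using \<alpha>\<beta> s nBR by (intro mult_mono) auto
    moreover have "\<alpha> * (nR - 1) \<le> \<alpha> * real N" using \<alpha>\<beta> nBR by (intro mult_left_mono) auto
    ultimately show ?thesis unfolding qB qR using \<alpha>\<beta>(4,5) by (simp add: algebra_simps)
  qed
  have SL: "0 < (2 * b + a) * L" using L_pos ba b1 by simp
  have "measure_pmf.prob (bernoulli_product ?E q) (- F) \<le> 1 / 2"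
  proof -
    have "measure_pmf.prob (bernoulli_product ?E q) {X. card {e \<in> star v B. X e} \<le> card {e \<in> star v R. X e}}
        \<le> exp (- (m\<^sup>2 / (4 * ((2 * b + a) * L))))"
      by (rule prob_plus_count_le_minus_count_quadratic[OF star_facts(1) star_facts(2)[OF v(1)] star_facts(3)[OF v(1)]
        disj q01 m0 m' SL S])
    also have "{X. card {e \<in> star v B. X e} \<le> card {e \<in> star v R. X e}} = - F"
      by (auto simp: F_def)
    finally show ?thesis using half by linarith
  qed
  then have QF: "1 / 2 \<le> measure_pmf.prob (bernoulli_product ?E q) F"
    using measure_pmf.prob_compl[of F "bernoulli_product ?E q"] by (simp add: Compl_eq_Diff_UNIV)
  have chi: "(\<Sum>e\<in>?E. (q e - ?p e)\<^sup>2 / (?p e * (1 - ?p e))) \<le> 2 * b * L * s\<^sup>2"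
  proof -
    have "(\<Sum>e\<in>?E. (q e - ?p e)\<^sup>2 / (?p e * (1 - ?p e))) = (\<Sum>e\<in>star v B. (q e - ?p e)\<^sup>2 / (?p e * (1 - ?p e)))"
      by (rule sum.mono_neutral_right) (use star_facts(2)[OF v(1)] in \<open>auto simp: q_def\<close>)
    also have "\<dots> \<le> (\<Sum>e\<in>star v B. 2 * \<beta> * s\<^sup>2)"
    proof (rule sum_mono)
      fix e assume e: "e \<in> star v B"
      have "(q e - ?p e)\<^sup>2 / (?p e * (1 - ?p e)) = \<beta> * s\<^sup>2 / (1 - \<beta>)"
      proof -
        have "?p e = \<beta>" using edge_prob_star(1)[OF v(1) e] v(2) by simp
        moreover have "q e - \<beta> = \<beta> * s" using e by (simp add: q_def algebra_simps)
        ultimately show ?thesis using \<alpha>\<beta>(1) by (simp add: power2_eq_square)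
      qed
      also have "\<dots> \<le> \<beta> * s\<^sup>2 / (1 / 2)"
        using \<alpha>\<beta> by (intro divide_left_mono) auto
      finally show "(q e - ?p e)\<^sup>2 / (?p e * (1 - ?p e)) \<le> 2 * \<beta> * s\<^sup>2" by simp
    qed
    also have "\<dots> = nB * (2 * \<beta> * s\<^sup>2)" by (simp add: card_star cards)
    also have "\<dots> \<le> real N * (2 * \<beta> * s\<^sup>2)" using nBR \<alpha>\<beta> by (intro mult_right_mono) auto
    also have "\<dots> = 2 * b * L * s\<^sup>2" using \<alpha>\<beta>(5) by (simp add: algebra_simps)
    finally show ?thesis .
  qed
  have p01: "0 < ?p e \<and> ?p e < 1" for e using edge_prob_bounds[of e] by simp
  have "1 / 4 \<le> (measure_pmf.prob (bernoulli_product ?E q) F)\<^sup>2"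
    using power_mono[OF QF, of 2] by (simp add: power2_eq_square)
  also have "\<dots> \<le> measure_pmf.prob (bernoulli_product ?E ?p) F * exp (\<Sum>e\<in>?E. (q e - ?p e)\<^sup>2 / (?p e * (1 - ?p e)))"
    by (rule bernoulli_product_change_of_measure) (use p01 q01 in auto)
  also have "\<dots> \<le> measure_pmf.prob (bernoulli_product ?E ?p) F * exp (2 * b * L * s\<^sup>2)"
    using chi by (intro mult_left_mono) auto
  also have "measure_pmf.prob (bernoulli_product ?E ?p) F \<le> measure_pmf.prob D {G. upd G v = 1}"
    unfolding prob_random_graph upd_star[OF v(1)]
    by (rule measure_pmf.finite_measure_mono) (auto simp: F_def)
  finally show ?thesis by (simp add: exp_minus field_simps)
qed

text \<open>
  Deleting the edge between \<open>u\<close> and \<open>v\<close>, which is an edge to a red vertex for both, can only help them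
  to turn blue, and without it the two events depend on disjoint stars. Deleting it changes each
  probability by at most \<open>\<alpha>\<close>, the probability that the edge is present.
\<close>

lemma prob_two_red_turn_blue_le:
  assumes u: "u \<in> R" and v: "v \<in> R" and uv: "u \<noteq> v"
  shows "measure_pmf.prob D ({G. upd G u = 1} \<inter> {G. upd G v = 1}) \<le>
    measure_pmf.prob D {G. upd G u = 1} * measure_pmf.prob D {G. upd G v = 1} + 3 * \<alpha>"
proof -
  let ?D = "bernoulli_product (vertex_pairs N) (edge_prob a b N y)"
  define F where "F w S = {X. card {e \<in> star w S. X e} < card {e \<in> star w B. X e}}" for w S
  have u': "u \<in> {1..N}" "y u = - 1" and v': "v \<in> {1..N}" "y v = - 1"
    using u v by (auto simp: red_def)
  have prF: "measure_pmf.prob D {G. upd G w = 1} = measure_pmf.prob ?D (F w R)" if "w \<in> {1..N}" "y w = - 1" for w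
    unfolding prob_random_graph upd_star[OF that(1)] using that(2)
    by (intro arg_cong[where f = "measure _"]) (auto simp: F_def)
  have prFF: "measure_pmf.prob D ({G. upd G u = 1} \<inter> {G. upd G v = 1}) = measure_pmf.prob ?D (F u R \<inter> F v R)"
    unfolding Collect_conj_eq[symmetric] prob_random_graph upd_star[OF u'(1)] upd_star[OF v'(1)]
    using u'(2) v'(2)
    by (intro arg_cong[where f = "measure _"]) (auto simp: F_def)
  have finR: "finite (star w S)" if "S \<subseteq> {1..N}" for w S using finite_subset[OF that] by simp
  have mono: "F w R \<subseteq> F w (R - {x})" for w x
  proof -
    have "card {e \<in> star w (R - {x}). X e} \<le> card {e \<in> star w R. X e}" for X
      by (rule card_mono) (use finR[OF BR(2)] star_mono[of "R - {x}" R] in auto)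
    then show ?thesis unfolding F_def using order.strict_trans1 by blast
  qed
  have single: "measure_pmf.prob ?D (F w (R - {x})) \<le> measure_pmf.prob ?D (F w R) + \<alpha>"
    if wx: "w \<in> R" "x \<in> R" "w \<noteq> x" for w x
  proof -
    have w: "w \<in> {1..N}" "y w = - 1" using wx by (auto simp: red_def)
    have xw: "{x, w} \<in> star w R" using wx by (auto simp: star_def)
    have E: "{x, w} \<in> vertex_pairs N" using xw star_facts(3)[OF w(1)] by blast
    have insert: "star w R = insert {x, w} (star w (R - {x}))" using wx by (auto simp: star_def)
    have "X \<in> F w R" if X: "X \<in> F w (R - {x})" "\<not> X {x, w}" for X
    proof -
      have "{e \<in> star w R. X e} = {e \<in> star w (R - {x}). X e}"
        unfolding insert using X(2) by blast
      then show ?thesis using X(1) by (simp add: F_def)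
    qed
    then have "F w (R - {x}) \<subseteq> F w R \<union> {X. X {x, w}}"
      by blast
    then have "measure_pmf.prob ?D (F w (R - {x})) \<le> measure_pmf.prob ?D (F w R \<union> {X. X {x, w}})"
      by (intro measure_pmf.finite_measure_mono) auto
    also have "\<dots> \<le> measure_pmf.prob ?D (F w R) + measure_pmf.prob ?D {X. X {x, w}}"
      by (rule measure_Un_le) auto
    also have "measure_pmf.prob ?D {X. X {x, w}} = measure_pmf.prob (map_pmf (\<lambda>X. X {x, w}) ?D) {True}"
      by (simp add: vimage_def)
    also have "\<dots> = edge_prob a b N y {x, w}"
      unfolding bernoulli_product_def using E edge_prob01[of "{x, w}"]
      by (simp add: Pi_pmf_component measure_pmf_single)
    also have "\<dots> = \<alpha>" using edge_prob_star(2)[OF w(1) xw] w(2) by simp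
    finally show ?thesis .
  qed
  let ?A = "star u (B \<union> (R - {v}))" and ?A' = "star v (B \<union> (R - {u}))"
  have "measure_pmf.prob ?D (F u R \<inter> F v R) \<le> measure_pmf.prob ?D (F u (R - {v}) \<inter> F v (R - {u}))"
    using mono by (intro measure_pmf.finite_measure_mono) auto
  also have "\<dots> = measure_pmf.prob ?D (F u (R - {v})) * measure_pmf.prob ?D (F v (R - {u}))"
    unfolding bernoulli_product_def
  proof (rule prob_Pi_pmf_indep[where A = ?A and B = ?A'])
    show "?A \<subseteq> vertex_pairs N" "?A' \<subseteq> vertex_pairs N"
      by (rule star_subset[OF _ u'(1)], use BR(1,2) in blast)
         (rule star_subset[OF _ v'(1)], use BR(1,2) in blast)
    show "?A \<inter> ?A' = {}"
      using uv u v BR(3) by (auto simp: star_def doubleton_eq_iff)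
    have dep: "X \<in> F w S \<longleftrightarrow> Y \<in> F w S" if "\<And>e. e \<in> star w (B \<union> S) \<Longrightarrow> X e = Y e" for w S X Y
    proof -
      have "{e \<in> star w S. X e} = {e \<in> star w S. Y e}" "{e \<in> star w B. X e} = {e \<in> star w B. Y e}"
        using that by (auto simp: star_Un)
      then show ?thesis by (simp add: F_def)
    qed
    show "X \<in> F u (R - {v}) \<longleftrightarrow> Y \<in> F u (R - {v})" if "\<And>e. e \<in> ?A \<Longrightarrow> X e = Y e" for X Y
      by (rule dep) (rule that)
    show "X \<in> F v (R - {u}) \<longleftrightarrow> Y \<in> F v (R - {u})" if "\<And>e. e \<in> ?A' \<Longrightarrow> X e = Y e" for X Y
      by (rule dep) (rule that)
  qed simp
  also have "\<dots> \<le> (measure_pmf.prob ?D (F u R) + \<alpha>) * (measure_pmf.prob ?D (F v R) + \<alpha>)"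
    using single[OF u v uv] single[OF v u uv[symmetric]] \<alpha>\<beta> by (intro mult_mono) auto
  also have "\<dots> = measure_pmf.prob ?D (F u R) * measure_pmf.prob ?D (F v R)
      + \<alpha> * (measure_pmf.prob ?D (F u R) + measure_pmf.prob ?D (F v R) + \<alpha>)"
    by (simp add: algebra_simps)
  also have "\<dots> \<le> measure_pmf.prob ?D (F u R) * measure_pmf.prob ?D (F v R) + \<alpha> * 3"
    using \<alpha>\<beta> measure_pmf.prob_le_1[of ?D "F u R"] measure_pmf.prob_le_1[of ?D "F v R"]
    by (intro add_left_mono mult_left_mono) linarith+
  finally show ?thesis unfolding prFF prF[OF u'] prF[OF v'] by simp
qed

section \<open>The number of red vertices after one round\<close>

lemma prob_few_red_turn_blue:
  assumes ne: "R \<noteq> {}" and r: "0 < r" "\<And>v. v \<in> R \<Longrightarrow> r \<le> measure_pmf.prob D {G. upd G v = 1}"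
  shows "measure_pmf.prob D {G. real (card {v \<in> R. upd G v = 1}) \<le> r * nR / 2}
    \<le> 4 / (r\<^sup>2 * nR) + 12 * \<alpha> / r\<^sup>2"
  using prob_count_le_half_mean[OF BR(6) ne finite_set_random_graph r prob_two_red_turn_blue_le] \<alpha>\<beta>
  by simp

lemma card_red_upd:
  "real (card (red N (upd G))) =
    nR - real (card {v \<in> R. upd G v = 1}) + real (card {v \<in> B. upd G v = - 1})"
proof -
  let ?RR = "{v \<in> R. upd G v = - 1}" and ?RB = "{v \<in> R. upd G v = 1}"
    and ?BR = "{v \<in> B. upd G v = - 1}"
  have "card (red N (upd G)) = card (?RR \<union> ?BR)"
  proof (rule arg_cong[where f = card], rule set_eqI)
    fix v
    show "v \<in> red N (upd G) \<longleftrightarrow> v \<in> ?RR \<union> ?BR"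
      using BR(4) unfolding red_def[of N "upd G"] by blast
  qed
  also have "\<dots> = card ?RR + card ?BR"
    by (rule card_Un_disjoint) (use BR(3,5,6) in auto)
  finally have new: "card (red N (upd G)) = card ?RR + card ?BR" .
  have "card R = card (?RR \<union> ?RB)"
  proof (rule arg_cong[where f = card], rule set_eqI)
    fix v
    show "v \<in> R \<longleftrightarrow> v \<in> ?RR \<union> ?RB"
      using upd_valid[of v G] BR(2) by blast
  qed
  also have "\<dots> = card ?RR + card ?RB"
    by (rule card_Un_disjoint) (use BR(6) in auto)
  finally show ?thesis using new by simp
qed

text \<open>
  The net loss of red vertices falls short only if too few red vertices turn blue (second moment) or
  too many blue vertices turn red (first moment).
\<close>

lemma prob_red_drop_too_small_le:
  assumes ne: "R \<noteq> {}" and r: "0 < r" "\<And>v. v \<in> R \<Longrightarrow> r \<le> measure_pmf.prob D {G. upd G v = 1}"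
    and c: "0 < c" and \<epsilon>: "\<And>v. v \<in> B \<Longrightarrow> measure_pmf.prob D {G. upd G v = - 1} \<le> \<epsilon>" "0 \<le> \<epsilon>"
  shows "measure_pmf.prob D {G. nR - r * nR / 2 + c < real (card (red N (upd G)))}
    \<le> 4 / (r\<^sup>2 * nR) + 12 * \<alpha> / r\<^sup>2 + real N * \<epsilon> / c"
proof -
  have "measure_pmf.prob D {G. nR - r * nR / 2 + c < real (card (red N (upd G)))} \<le>
     measure_pmf.prob D ({G. real (card {v \<in> R. upd G v = 1}) \<le> r * nR / 2}
       \<union> {G. c \<le> real (card {v \<in> B. G \<in> {G. upd G v = - 1}})})"
    unfolding card_red_upd by (rule measure_pmf.finite_measure_mono) auto
  also have "\<dots> \<le> measure_pmf.prob D {G. real (card {v \<in> R. upd G v = 1}) \<le> r * nR / 2}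
      + measure_pmf.prob D {G. c \<le> real (card {v \<in> B. G \<in> {G. upd G v = - 1}})}"
    by (rule measure_Un_le) auto
  also have "\<dots> \<le> (4 / (r\<^sup>2 * nR) + 12 * \<alpha> / r\<^sup>2) + nB * \<epsilon> / c"
    by (intro add_mono prob_few_red_turn_blue[OF ne r] prob_count_ge_Markov BR finite_set_random_graph c \<epsilon>)
  also have "nB * \<epsilon> / c \<le> real N * \<epsilon> / c"
    using nBR \<epsilon> c by (intro divide_right_mono mult_right_mono) auto
  finally show ?thesis by simp
qed

lemma prob_many_red:
  assumes c: "0 < c" and \<epsilon>: "\<And>v. v \<in> {1..N} \<Longrightarrow> measure_pmf.prob D {G. upd G v = - 1} \<le> \<epsilon>"
  shows "measure_pmf.prob D {G. c \<le> real (card (red N (upd G)))} \<le> real N * \<epsilon> / c"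
  using prob_count_ge_Markov[of "{1..N}" D c "\<lambda>v. {G. upd G v = - 1}" \<epsilon>] finite_set_random_graph c \<epsilon>
  by (simp add: red_def)

text \<open>
  At the threshold \<open>R = b N / (a + b)\<close> a blue vertex expects \<open>(a - b) L\<close> more blue than red
  neighbours; the error terms consume at most half of this.
\<close>

lemma prob_blue_turns_red_le:
  assumes \<eta>: "\<eta> + a / real N \<le> (a - b) / 2" and R: "nR \<le> (b + \<eta>) * real N / (a + b)"
    and \<xi>: "\<xi> \<le> (a - b)\<^sup>2 / (16 * a)" and v: "v \<in> B"
  shows "measure_pmf.prob D {G. upd G v = - 1} \<le> exp (- (\<xi> * L))"
proof -
  have v': "v \<in> {1..N}" "y v = 1" using v by (auto simp: blue_def)
  have N: "real N > 0" using N2 by simp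
  define m where "m = L * (a - b) / 2"
  have "\<alpha> * (nB - 1) - \<beta> * nR = L / real N * (a * (real N - nR - 1) - b * nR)"
  proof -
    have "nB = real N - nR" using nBR by simp
    then show ?thesis by (simp add: \<alpha>_def \<beta>_def diff_divide_distrib right_diff_distrib mult_ac)
  qed
  also have "\<dots> = L / real N * (a * real N - (a + b) * nR - a)" by (simp add: algebra_simps)
  also have "\<dots> \<ge> L / real N * (a * real N - (b + \<eta>) * real N - a)"
  proof -
    have "(a + b) * nR \<le> (b + \<eta>) * real N" using R b1 ba by (simp add: field_simps)
    then show ?thesis using L_pos N by (intro mult_left_mono) auto
  qed
  also have "L / real N * (a * real N - (b + \<eta>) * real N - a) = L * (a - b - (\<eta> + a / real N))"
    using N by (simp add: field_simps)
  also have "\<dots> \<ge> L * ((a - b) - (a - b) / 2)"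
    by (rule mult_left_mono[OF diff_left_mono[OF \<eta>]]) (use L_pos in simp)
  also have "L * ((a - b) - (a - b) / 2) = m" by (simp add: m_def field_simps)
  finally have m: "m \<le> \<alpha> * (nB - 1) - \<beta> * nR" .
  have "0 \<le> m" using L_pos ba by (simp add: m_def)
  then have "measure_pmf.prob D {G. upd G v = - 1} \<le> exp (- (m\<^sup>2 / (4 * (a * L))))"
    by (rule prob_upd_red_quadratic[OF v'(1)]) (use m v'(2) in auto)
  also have "m\<^sup>2 / (4 * (a * L)) = (a - b)\<^sup>2 / (16 * a) * L"
    using L_pos ba b1 by (simp add: m_def power_mult_distrib power_divide power2_eq_square)
  also have "exp (- ((a - b)\<^sup>2 / (16 * a) * L)) \<le> exp (- (\<xi> * L))"
    using mult_right_mono[OF \<xi>, of L] L_pos by simp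
  finally show ?thesis .
qed

text \<open>
  With at most \<open>b N / (2 (a + b))\<close> red vertices, half the number at the threshold, even a red vertex
  expects a blue majority of at least \<open>b L / 2\<close>.
\<close>

lemma prob_upd_red_le_of_few_red:
  assumes N: "a / real N \<le> (a - b) / 2" and R: "nR \<le> b / (2 * (a + b)) * real N"
    and \<xi>: "\<xi> \<le> (a - b)\<^sup>2 / (16 * a)" "\<xi> \<le> b\<^sup>2 / (16 * a)" and v: "v \<in> {1..N}"
  shows "measure_pmf.prob D {G. upd G v = - 1} \<le> exp (- (\<xi> * L))"
proof (cases "y v = 1")
  case True
  have "nR \<le> (b + 0) * real N / (a + b)"
  proof -
    have "b / (2 * (a + b)) \<le> b / (a + b)" using b1 ba by (intro divide_left_mono) auto
    then show ?thesis using R mult_right_mono[of "b / (2 * (a + b))" "b / (a + b)" "real N"] by simp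
  qed
  then show ?thesis using N \<xi> v True by (intro prob_blue_turns_red_le[of 0]) (auto simp: blue_def)
next
  case False
  then have red: "y v = - 1" using valid[OF v] by simp
  have N0: "real N > 0" using N2 by simp
  define m where "m = L * b / 2"
  have "\<beta> * nB - \<alpha> * nR = L / real N * (b * (real N - nR) - a * nR)"
    by (simp add: \<alpha>_def \<beta>_def algebra_simps diff_divide_distrib flip: nBR)
  also have "\<dots> = L / real N * (b * real N - (a + b) * nR)" by (simp add: algebra_simps)
  also have "\<dots> \<ge> L / real N * (b * real N - b * real N / 2)"
  proof -
    have "(a + b) * nR \<le> b * real N / 2" using R b1 ba by (simp add: field_simps)
    then show ?thesis using L_pos N0 by (intro mult_left_mono) auto
  qed
  also have "L / real N * (b * real N - b * real N / 2) = m" using N0 by (simp add: m_def field_simps)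
  finally have m: "m \<le> \<beta> * nB - \<alpha> * (nR - 1)" using \<alpha>\<beta> by (simp add: algebra_simps)
  have "0 \<le> m" using L_pos b1 by (simp add: m_def)
  then have "measure_pmf.prob D {G. upd G v = - 1} \<le> exp (- (m\<^sup>2 / (4 * (a * L))))"
    by (rule prob_upd_red_quadratic[OF v]) (use m red in auto)
  also have "m\<^sup>2 / (4 * (a * L)) = b\<^sup>2 / (16 * a) * L"
    using L_pos ba b1 by (simp add: m_def power_mult_distrib power_divide power2_eq_square)
  also have "exp (- (b\<^sup>2 / (16 * a) * L)) \<le> exp (- (\<xi> * L))"
    using mult_right_mono[OF \<xi>(2), of L] L_pos by simp
  finally show ?thesis .
qed

text \<open>
  The expected deficit of a red vertex is at most \<open>\<eta> L\<close>. Raising \<open>\<beta>\<close> by the factor \<open>1 + K \<eta>\<close> adds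
  \<open>K \<eta> \<beta> B\<close>, and as \<open>B \<ge> a N / (2 (a + b))\<close> the value of \<open>K\<close> is such that this is at least \<open>2 \<eta> L\<close>.
  So the raised law has an expected blue majority of at least \<open>m = \<eta> L\<close>.
\<close>

lemma prob_red_turns_blue_ge_of_deficit:
  defines "K \<equiv> 4 * (a + b) / (a * b)"
  assumes \<eta>: "0 \<le> \<eta>" "\<eta> \<le> a / 2" "K * \<eta> \<le> 1" and R: "nR \<le> (b + \<eta>) * real N / (a + b)"
    and half: "exp (- (L * \<eta>\<^sup>2 / (4 * (2 * b + a)))) \<le> 1 / 2" and v: "v \<in> R"
  shows "exp (- (2 * b * K\<^sup>2 * (L * \<eta>\<^sup>2))) / 4 \<le> measure_pmf.prob D {G. upd G v = 1}"
proof -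
  have v': "v \<in> {1..N}" "y v = - 1" using v by (auto simp: red_def)
  have N: "real N > 0" using N2 by simp
  have K0: "0 \<le> K" using b1 ba by (simp add: K_def)
  define m where "m = L * \<eta>"
  have abR: "(a + b) * nR \<le> (b + \<eta>) * real N" using R b1 ba by (simp add: field_simps)
  have abB: "a / 2 * real N \<le> (a + b) * nB"
  proof -
    have "(a + b) * nB = (a + b) * real N - (a + b) * nR"
      by (simp add: algebra_simps flip: nBR)
    also have "\<dots> \<ge> (a + b) * real N - (b + \<eta>) * real N" using abR by simp
    also have "(a + b) * real N - (b + \<eta>) * real N = (a - \<eta>) * real N" by (simp add: algebra_simps)
    also have "\<dots> \<ge> a / 2 * real N" using \<eta> N by (intro mult_right_mono) auto
    finally show ?thesis by simp
  qed
  have gain: "2 * \<eta> * real N \<le> b * K * \<eta> * nB"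
  proof -
    have "b * K * \<eta> * nB = 4 * \<eta> / a * ((a + b) * nB)"
      using b1 ba by (simp add: K_def)
    also have "\<dots> \<ge> 4 * \<eta> / a * (a / 2 * real N)"
      using abB \<eta> b1 ba by (intro mult_left_mono) auto
    also have "4 * \<eta> / a * (a / 2 * real N) = 2 * \<eta> * real N" using b1 ba by simp
    finally show ?thesis .
  qed
  have "\<beta> * (1 + K * \<eta>) * nB - \<alpha> * nR = L / real N * (b * (real N - nR) + b * K * \<eta> * nB - a * nR)"
    by (simp add: \<alpha>_def \<beta>_def algebra_simps diff_divide_distrib add_divide_distrib flip: nBR)
  also have "\<dots> = L / real N * (b * real N - (a + b) * nR + b * K * \<eta> * nB)" by (simp add: algebra_simps)
  also have "\<dots> \<ge> L / real N * (b * real N - (b + \<eta>) * real N + 2 * \<eta> * real N)"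
    using L_pos N abR gain by (intro mult_left_mono) auto
  also have "L / real N * (b * real N - (b + \<eta>) * real N + 2 * \<eta> * real N) = m"
    using N by (simp add: m_def field_simps)
  finally have m: "m \<le> \<beta> * (1 + K * \<eta>) * nB - \<alpha> * nR" .
  have "0 \<le> m" using L_pos \<eta> by (simp add: m_def)
  moreover have "m\<^sup>2 / (4 * ((2 * b + a) * L)) = L * \<eta>\<^sup>2 / (4 * (2 * b + a))"
    using L_pos by (simp add: m_def power_mult_distrib power2_eq_square)
  ultimately have "exp (- (2 * b * L * (K * \<eta>)\<^sup>2)) / 4 \<le> measure_pmf.prob D {G. upd G v = 1}"
    using K0 \<eta> half m by (intro prob_red_turns_blue_ge[OF v', where m = m]) auto
  then show ?thesis by (simp add: power_mult_distrib algebra_simps)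
qed

text \<open>
  The Chernoff parameter \<open>t\<close> solves \<open>b (1 - exp (- t)) = (1 + b) / 2\<close>, which is possible because the
  right-hand side is less than \<open>b\<close>. As it exceeds \<open>1\<close>, the few red neighbours still leave a
  probability of at most \<open>N\<close> to the power \<open>- (3 + b) / 4\<close> per vertex, and the union bound over \<open>N\<close>
  vertices leaves \<open>N\<close> to the power \<open>- (b - 1) / 4\<close>.
\<close>

lemma prob_any_red_le_of_very_few_red:
  assumes R: "nR \<le> real N * \<delta>"
    and \<delta>: "(3 + b) / 4 \<le> (1 + b) / 2 * (1 - \<delta> - 1 / real N) - 2 * b / (b - 1) * a * \<delta>"
  shows "measure_pmf.prob D {G. red N (upd G) \<noteq> {}} \<le> exp (- ((b - 1) / 4 * L))"
proof -
  have N: "real N > 0" using N2 by simp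
  define t where "t = ln (2 * b / (b - 1))"
  have et: "exp t = 2 * b / (b - 1)" unfolding t_def using b1 by (subst exp_ln) auto
  have t0: "0 \<le> t" unfolding t_def using b1 by (intro ln_ge_zero) (auto simp: field_simps)
  have emt: "b * (1 - exp (- t)) = (1 + b) / 2"
    unfolding exp_minus et using b1 by (simp add: field_simps)
  have one: "measure_pmf.prob D {G. upd G v = - 1} \<le> exp (- ((3 + b) / 4 * L))" if v: "v \<in> {1..N}" for v
  proof -
    have "(1 - exp (- t)) * (\<beta> * (nB - 1)) = b * (1 - exp (- t)) * (L * ((nB - 1) / real N))"
      by (simp add: \<beta>_def)
    also have "\<dots> = (1 + b) / 2 * (L * ((nB - 1) / real N))" unfolding emt ..
    also have "\<dots> \<ge> (1 + b) / 2 * (L * (1 - \<delta> - 1 / real N))"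
    proof (intro mult_left_mono)
      have "(1 - \<delta> - 1 / real N) * real N \<le> nB - 1"
        using R nBR N by (simp add: algebra_simps)
      then show "1 - \<delta> - 1 / real N \<le> (nB - 1) / real N"
        using N by (simp add: pos_le_divide_eq)
    qed (use L_pos b1 in auto)
    finally have 1: "(1 + b) / 2 * (L * (1 - \<delta> - 1 / real N)) \<le> (1 - exp (- t)) * (\<beta> * (nB - 1))" .
    have "(exp t - 1) * (\<alpha> * nR) \<le> exp t * (\<alpha> * nR)" using \<alpha>\<beta> by (intro mult_right_mono) auto
    also have "\<dots> \<le> exp t * (\<alpha> * (real N * \<delta>))" using R \<alpha>\<beta> by (intro mult_left_mono) auto
    also have "\<alpha> * (real N * \<delta>) = a * L * \<delta>" using \<alpha>\<beta>(4) by (metis mult.assoc mult.commute)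
    finally have 2: "(exp t - 1) * (\<alpha> * nR) \<le> 2 * b / (b - 1) * (a * L * \<delta>)" unfolding et .
    have "(3 + b) / 4 * L \<le> ((1 + b) / 2 * (1 - \<delta> - 1 / real N) - 2 * b / (b - 1) * a * \<delta>) * L"
      using \<delta> L_pos by (intro mult_right_mono) auto
    also have "\<dots> = (1 + b) / 2 * (L * (1 - \<delta> - 1 / real N)) - 2 * b / (b - 1) * (a * L * \<delta>)"
    proof -
      have "(P * X - Q * a * \<delta>) * L = P * (L * X) - Q * (a * L * \<delta>)" for P Q X :: real
        by (simp add: algebra_simps)
      then show ?thesis .
    qed
    finally have "- ((1 - exp (- t)) * (\<beta> * (nB - 1))) + (exp t - 1) * (\<alpha> * nR) \<le> - ((3 + b) / 4 * L)"
      using 1 2 by linarith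
    then show ?thesis using prob_upd_red_exp[OF v t0] by (meson exp_le_cancel_iff order.trans)
  qed
  have "{G. red N (upd G) \<noteq> {}} = {G. 1 \<le> real (card (red N (upd G)))}"
    by (auto simp: red_def Suc_le_eq card_gt_0_iff)
  then have "measure_pmf.prob D {G. red N (upd G) \<noteq> {}} \<le> real N * exp (- ((3 + b) / 4 * L)) / 1"
    using prob_many_red[OF _ one, of 1] by simp
  also have "\<dots> = exp L * exp (- ((3 + b) / 4 * L))" using N by (simp add: L_def)
  also have "\<dots> = exp (- ((b - 1) / 4 * L))" by (simp flip: exp_add add: field_simps)
  finally show ?thesis .
qed

text \<open>
  Markov's inequality for the number of red vertices, whose mean is at most \<open>N exp (- \<xi> L)\<close>: half of
  the exponent goes into the count and half into the probability.
\<close>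

lemma prob_red_not_few_le:
  assumes N: "a / real N \<le> (a - b) / 2" and R: "nR \<le> b / (2 * (a + b)) * real N"
    and \<xi>: "\<xi> \<le> (a - b)\<^sup>2 / (16 * a)" "\<xi> \<le> b\<^sup>2 / (16 * a)"
  shows "measure_pmf.prob D {G. real N * exp (- (\<xi> / 2 * L)) < real (card (red N (upd G)))}
    \<le> exp (- (\<xi> / 2 * L))"
proof -
  have N0: "real N > 0" using N2 by simp
  have "measure_pmf.prob D {G. real N * exp (- (\<xi> / 2 * L)) < real (card (red N (upd G)))}
      \<le> measure_pmf.prob D {G. real N * exp (- (\<xi> / 2 * L)) \<le> real (card (red N (upd G)))}"
    by (rule measure_pmf.finite_measure_mono) auto
  also have "\<dots> \<le> real N * exp (- (\<xi> * L)) / (real N * exp (- (\<xi> / 2 * L)))"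
    by (rule prob_many_red) (use N0 prob_upd_red_le_of_few_red[OF N R \<xi>] in auto)
  also have "\<dots> = exp (- (\<xi> / 2 * L))" using N0 by (simp flip: exp_diff)
  finally show ?thesis .
qed

text \<open>
  While there are at least \<open>\<rho> N\<close> red vertices, a typical round turns at least \<open>r \<rho> N / 2\<close> of them blue. The
  hypothesis \<open>small\<close> says that the blue vertices turning red use up at most half of that gain.
\<close>

lemma prob_red_not_shrinking_le:
  defines "K \<equiv> 4 * (a + b) / (a * b)" and "\<rho> \<equiv> b / (2 * (a + b))"
  defines "r \<equiv> \<lambda>u. exp (- (2 * b * K\<^sup>2 * u)) / 4"
  assumes N: "\<eta> + a / real N \<le> (a - b) / 2" and \<eta>: "0 \<le> \<eta>" "\<eta> \<le> a / 2" "K * \<eta> \<le> 1"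
    and R: "nR \<le> (b + \<eta>) * real N / (a + b)" and R_ge: "\<rho> * real N \<le> nR"
    and half: "exp (- (L * \<eta>\<^sup>2 / (4 * (2 * b + a)))) \<le> 1 / 2"
    and \<xi>: "\<xi> \<le> (a - b)\<^sup>2 / (16 * a)"
    and small: "exp (- (\<xi> / 2 * L)) \<le> r (L * \<eta>\<^sup>2) * \<rho> / 4"
  shows "measure_pmf.prob D {G. nR - r (L * \<eta>\<^sup>2) * \<rho> / 4 * real N < real (card (red N (upd G)))}
    \<le> (4 / \<rho> + 12 * a * L) / ((r (L * \<eta>\<^sup>2))\<^sup>2 * real N) + exp (- (\<xi> / 2 * L))"
proof -
  let ?r = "r (L * \<eta>\<^sup>2)" and ?c = "real N * exp (- (\<xi> / 2 * L))"
  have N0: "real N > 0" using N2 by simp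
  have r0: "0 < ?r" and \<rho>0: "0 < \<rho>" using b1 ba by (auto simp: r_def \<rho>_def)
  have nR0: "0 < nR" using R_ge \<rho>0 N0 by (meson mult_pos_pos order.strict_trans2)
  then have ne: "R \<noteq> {}" by auto
  have "?r * (\<rho> * real N) \<le> ?r * nR" using R_ge r0 by (intro mult_left_mono) auto
  moreover have "?c \<le> real N * (?r * \<rho> / 4)" using small N0 by (intro mult_left_mono) auto
  ultimately have step: "nR - ?r * nR / 2 + ?c \<le> nR - ?r * \<rho> / 4 * real N"
    by (simp add: algebra_simps)
  have "measure_pmf.prob D {G. nR - ?r * \<rho> / 4 * real N < real (card (red N (upd G)))}
    \<le> measure_pmf.prob D {G. nR - ?r * nR / 2 + ?c < real (card (red N (upd G)))}"
    by (rule measure_pmf.finite_measure_mono) (use step in auto)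
  also have "\<dots> \<le> 4 / (?r\<^sup>2 * nR) + 12 * \<alpha> / ?r\<^sup>2 + real N * exp (- (\<xi> * L)) / ?c"
  proof (rule prob_red_drop_too_small_le[OF ne r0])
    show "?r \<le> measure_pmf.prob D {G. upd G v = 1}" if "v \<in> R" for v
      unfolding r_def K_def
      using prob_red_turns_blue_ge_of_deficit[OF \<eta>(1,2) \<eta>(3)[unfolded K_def] R half that] .
    show "measure_pmf.prob D {G. upd G v = - 1} \<le> exp (- (\<xi> * L))" if "v \<in> B" for v
      by (rule prob_blue_turns_red_le[OF N R \<xi> that])
  qed (use N0 in auto)
  also have "real N * exp (- (\<xi> * L)) / ?c = exp (- (\<xi> / 2 * L))"
    using N0 by (simp flip: exp_diff)
  also have "4 / (?r\<^sup>2 * nR) \<le> 4 / (?r\<^sup>2 * (\<rho> * real N))"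
    using R_ge r0 \<rho>0 N0 nR0 by (intro divide_left_mono mult_left_mono) auto
  also have "4 / (?r\<^sup>2 * (\<rho> * real N)) + 12 * \<alpha> / ?r\<^sup>2 = (4 / \<rho> + 12 * a * L) / (?r\<^sup>2 * real N)"
    using N0 r0 \<rho>0 by (simp add: \<alpha>_def field_simps)
  finally show ?thesis by simp
qed

end

section \<open>Many rounds\<close>

lemma red_empty_absorbing:
  assumes "red N y = {}" "\<And>v. v \<in> {1..N} \<Longrightarrow> y v = 1 \<or> y v = - 1"
  shows "red N (majority_update N G y) = {}"
proof -
  have "y v = 1" if "v \<in> {1..N}" for v
    using assms(2)[OF that] assms(1) that by (auto simp: red_def)
  then have "majority_update N G y v \<noteq> - 1" if "v \<in> {1..N}" for v
    using that assms(1) by (simp add: majority_update_def Let_def)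
  then show ?thesis by (auto simp: red_def)
qed

text \<open>
  A union bound over the rounds for an invariant \<open>\<Phi> t\<close> that may vary with time.
\<close>

lemma prob_graph_history_chain:
  fixes \<Phi> :: "nat \<Rightarrow> opinions \<Rightarrow> bool"
  assumes "\<Phi> 0 y0"
    and step: "\<And>t y. t < n \<Longrightarrow> \<Phi> t y \<Longrightarrow>
      measure_pmf.prob (random_graph a b N y) {G. \<not> \<Phi> (Suc t) (majority_update N G y)} \<le> \<epsilon>"
    and \<epsilon>: "0 \<le> \<epsilon>" and tn: "t \<le> n"
  shows "measure_pmf.prob (graph_history a b N y0 t) {Gs. \<not> \<Phi> t (opinions_after N y0 Gs)} \<le> real t * \<epsilon>"
  using tn
proof (induction t)
  case 0
  then show ?case using assms(1) by (simp add: opinions_after_def)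
next
  case (Suc t)
  let ?M = "graph_history a b N y0 t"
  let ?bad = "{Gs. \<not> \<Phi> t (opinions_after N y0 Gs)}"
  let ?K = "\<lambda>Gs. map_pmf (\<lambda>G. Gs @ [G]) (random_graph a b N (opinions_after N y0 Gs))"
  let ?A = "{Gs. \<not> \<Phi> (Suc t) (opinions_after N y0 Gs)}"
  have K: "emeasure (?K Gs) ?A \<le> indicator ?bad Gs + ennreal \<epsilon>" for Gs
  proof (cases "Gs \<in> ?bad")
    case True
    have "emeasure (?K Gs) ?A \<le> 1" by (rule measure_pmf.emeasure_le_1)
    also have "1 \<le> indicator ?bad Gs + ennreal \<epsilon>" using True by simp
    finally show ?thesis .
  next
    case False
    have "measure_pmf.prob (?K Gs) ?A \<le> \<epsilon>"
      using step[of t "opinions_after N y0 Gs"] False Suc.prems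
      by (simp add: vimage_def opinions_after_def)
    then show ?thesis using False \<epsilon>
      by (simp add: measure_pmf.emeasure_eq_measure ennreal_leI)
  qed
  have "emeasure (graph_history a b N y0 (Suc t)) ?A = (\<integral>\<^sup>+Gs. emeasure (?K Gs) ?A \<partial>?M)"
    by simp
  also have "\<dots> \<le> (\<integral>\<^sup>+Gs. indicator ?bad Gs + ennreal \<epsilon> \<partial>?M)"
    by (rule nn_integral_mono) (rule K)
  also have "\<dots> = emeasure ?M ?bad + ennreal \<epsilon>"
    by (subst nn_integral_add) auto
  also have "\<dots> = ennreal (measure_pmf.prob ?M ?bad + \<epsilon>)"
    using \<epsilon> by (simp add: measure_pmf.emeasure_eq_measure ennreal_plus del: graph_history.simps)
  finally have "measure_pmf.prob (graph_history a b N y0 (Suc t)) ?A \<le> measure_pmf.prob ?M ?bad + \<epsilon>"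
    using \<epsilon> unfolding measure_pmf.emeasure_eq_measure
    by (subst (asm) ennreal_le_iff) simp_all
  then show ?case using Suc by (simp add: algebra_simps)
qed

text \<open>
  The non-asymptotic form of the theorem. The invariant lets the number of red vertices decrease
  linearly in time until it is below \<open>\<rho> N\<close>, where it then stays: from below \<open>\<rho> N\<close> the next round
  even reaches \<open>\<delta> N \<le> \<rho> N\<close>. By time \<open>T\<close> the linear bound has become negative, and the last three
  rounds reach \<open>\<delta> N\<close>, then \<open>0\<close>, then \<open>0\<close> again.
\<close>

lemma prob_red_survives_le:
  fixes a b \<eta> \<xi> :: real and N T :: nat and y0 :: opinions
  defines "L \<equiv> ln (real N)"
  defines "K \<equiv> 4 * (a + b) / (a * b)" and "\<rho> \<equiv> b / (2 * (a + b))"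
  defines "r \<equiv> exp (- (2 * b * K\<^sup>2 * (L * \<eta>\<^sup>2))) / 4"
  defines "\<delta> \<equiv> exp (- (\<xi> / 2 * L))"
  assumes ab: "1 < b" "b < a" and N2: "2 \<le> N" and small: "a * L / real N \<le> 1 / 2"
    and \<xi>: "\<xi> \<le> (a - b)\<^sup>2 / (16 * a)" "\<xi> \<le> b\<^sup>2 / (16 * a)"
    and \<eta>: "0 \<le> \<eta>" "\<eta> \<le> a / 2" "K * \<eta> \<le> 1" "\<eta> + a / real N \<le> (a - b) / 2"
    and half: "exp (- (L * \<eta>\<^sup>2 / (4 * (2 * b + a)))) \<le> 1 / 2"
    and \<delta>: "\<delta> \<le> r * \<rho> / 4"
      "(3 + b) / 4 \<le> (1 + b) / 2 * (1 - \<delta> - 1 / real N) - 2 * b / (b - 1) * a * \<delta>"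
    and T: "4 / (r * \<rho>) \<le> real T"
    and \<epsilon>: "(4 / \<rho> + 12 * a * L) / (r\<^sup>2 * real N) + \<delta> \<le> \<epsilon>" "exp (- ((b - 1) / 4 * L)) \<le> \<epsilon>"
    and valid: "\<And>v. v \<in> {1..N} \<Longrightarrow> y0 v = 1 \<or> y0 v = - 1"
    and adv: "- \<eta> * real N \<le> weighted_advantage a b N y0"
  shows "measure_pmf.prob (graph_history a b N y0 (T + 3)) {Gs. red N (opinions_after N y0 Gs) \<noteq> {}}
    \<le> real (T + 3) * \<epsilon>"
proof -
  define g where "g = r * \<rho> / 4"
  define x0 where "x0 = (b + \<eta>) * real N / (a + b)"
  have N0: "real N > 0" using N2 by simp
  have L0: "0 < L" using N2 by (simp add: L_def)
  have r0: "0 < r" "r \<le> 1"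
  proof -
    have "0 \<le> 2 * b * K\<^sup>2 * (L * \<eta>\<^sup>2)" using ab L0 by simp
    then have "exp (- (2 * b * K\<^sup>2 * (L * \<eta>\<^sup>2))) \<le> 1" by simp
    then show "r \<le> 1" unfolding r_def by linarith
  qed (simp add: r_def)
  have \<rho>0: "0 < \<rho>" using ab by (simp add: \<rho>_def)
  have g0: "0 < g" using r0 \<rho>0 by (simp add: g_def)
  have \<delta>0: "0 < \<delta>" by (simp add: \<delta>_def)
  have \<delta>\<rho>: "\<delta> \<le> \<rho>" using \<delta>(1) mult_right_mono[OF r0(2), of \<rho>] \<rho>0 by linarith
  have \<epsilon>\<delta>: "\<delta> \<le> \<epsilon>"
  proof -
    have "0 \<le> (4 / \<rho> + 12 * a * L) / (r\<^sup>2 * real N)" using \<rho>0 L0 N0 ab by simp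
    then show ?thesis using \<epsilon>(1) by linarith
  qed
  have aN: "a / real N \<le> (a - b) / 2" using \<eta> by simp
  \<comment> \<open>The maximum lets the invariant survive a round that starts below \<open>\<rho> N\<close> before time \<open>T\<close>.\<close>
  define \<Phi> where "\<Phi> t y \<longleftrightarrow> (\<forall>v\<in>{1..N}. y v = 1 \<or> y v = - 1) \<and>
    (if t \<le> T then real (card (red N y)) \<le> max (\<rho> * real N) (x0 - real t * (g * real N))
     else if t = T + 1 then real (card (red N y)) \<le> real N * \<delta> else red N y = {})" for t y
  have start: "\<Phi> 0 y0"
  proof -
    interpret majority_step a b N y0
      by unfold_locales (use ab N2 small valid in \<open>auto simp: L_def\<close>)
    have "b * (real N - nR) - a * nR \<ge> - \<eta> * real N"
      using adv by (simp add: weighted_advantage_def flip: nBR)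
    then have "nR \<le> x0" using ab by (simp add: x0_def field_simps)
    then show ?thesis using valid by (simp add: \<Phi>_def)
  qed
  have step: "measure_pmf.prob (random_graph a b N y) {G. \<not> \<Phi> (Suc t) (majority_update N G y)} \<le> \<epsilon>"
    if t: "t < T + 3" and \<Phi>: "\<Phi> t y" for t y
  proof -
    interpret S: majority_step a b N y
      by unfold_locales (use ab N2 small \<Phi> in \<open>auto simp: L_def \<Phi>_def\<close>)
    have LL: "S.L = L" by (simp add: S.L_def L_def)
    note val = S.upd_valid
    have few: "measure_pmf.prob S.D {G. real N * \<delta> < real (card (red N (S.upd G)))} \<le> \<epsilon>"
      if "S.nR \<le> \<rho> * real N"
      using S.prob_red_not_few_le[OF aN that[unfolded \<rho>_def] \<xi>] \<epsilon>\<delta> by (simp add: LL \<delta>_def)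
    have mono: "measure_pmf.prob S.D {G. \<not> \<Phi> (Suc t) (S.upd G)} \<le> measure_pmf.prob S.D {G. Q G}"
      if "\<And>G. \<not> Q G \<Longrightarrow> \<Phi> (Suc t) (S.upd G)" for Q
      by (rule measure_pmf.finite_measure_mono) (use that in auto)
    consider "t < T" "S.nR \<le> \<rho> * real N" | "t < T" "\<rho> * real N < S.nR" | "t = T" | "t = T + 1" | "t = T + 2"
      using t by linarith
    then show ?thesis
    proof cases
      case 1
      have "real N * \<delta> \<le> \<rho> * real N" using \<delta>\<rho> N0 by simp
      then have "measure_pmf.prob S.D {G. \<not> \<Phi> (Suc t) (S.upd G)} \<le>
          measure_pmf.prob S.D {G. real N * \<delta> < real (card (red N (S.upd G)))}"
        using 1(1) val by (intro mono) (auto simp: \<Phi>_def)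
      then show ?thesis using few[OF 1(2)] by linarith
    next
      case 2
      then have R: "S.nR \<le> x0 - real t * (g * real N)" using \<Phi> unfolding \<Phi>_def le_max_iff_disj by auto
      have "0 \<le> real t * (g * real N)" using g0 N0 by simp
      with R have R': "S.nR \<le> (b + \<eta>) * real N / (a + b)" unfolding x0_def by linarith
      have "measure_pmf.prob S.D {G. \<not> \<Phi> (Suc t) (S.upd G)} \<le>
          measure_pmf.prob S.D {G. S.nR - g * real N < real (card (red N (S.upd G)))}"
        using 2(1) val R by (intro mono) (auto simp: \<Phi>_def algebra_simps)
      also have "\<dots> \<le> (4 / \<rho> + 12 * a * L) / (r\<^sup>2 * real N) + \<delta>"
        using S.prob_red_not_shrinking_le[OF \<eta>(4,1,2) \<eta>(3)[unfolded K_def] R', of \<xi>] 2(2) half \<xi> \<delta>(1)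
        unfolding LL \<rho>_def[symmetric] K_def[symmetric] r_def[symmetric] \<delta>_def[symmetric] g_def[symmetric]
        by simp
      finally show ?thesis using \<epsilon>(1) by linarith
    next
      case 3
      have "S.nR \<le> \<rho> * real N"
      proof -
        have "1 \<le> real T * g" using T r0 \<rho>0 by (simp add: g_def field_simps)
        then have "1 * real N \<le> real T * g * real N" using N0 by (intro mult_right_mono) auto
        moreover have "x0 \<le> real N"
          using \<eta>(2) ab N0 unfolding x0_def by (simp add: divide_le_eq mult.commute)
        ultimately have "x0 - real T * (g * real N) \<le> 0" by (simp add: mult.assoc)
        moreover have "0 \<le> \<rho> * real N" using \<rho>0 by simp
        ultimately show ?thesis using \<Phi> 3 by (simp add: \<Phi>_def)
      qed
      moreover have "measure_pmf.prob S.D {G. \<not> \<Phi> (Suc t) (S.upd G)} \<le>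
          measure_pmf.prob S.D {G. real N * \<delta> < real (card (red N (S.upd G)))}"
        using 3 val by (intro mono) (auto simp: \<Phi>_def)
      ultimately show ?thesis using few by linarith
    next
      case 4
      then have R: "S.nR \<le> real N * \<delta>" using \<Phi> by (simp add: \<Phi>_def)
      have "measure_pmf.prob S.D {G. \<not> \<Phi> (Suc t) (S.upd G)} \<le>
          measure_pmf.prob S.D {G. red N (S.upd G) \<noteq> {}}"
        using 4 val by (intro mono) (auto simp: \<Phi>_def)
      then show ?thesis
        using S.prob_any_red_le_of_very_few_red[OF R \<delta>(2)] \<epsilon>(2) unfolding LL by linarith
    next
      case 5
      then have "red N y = {}" using \<Phi> by (simp add: \<Phi>_def)
      then have "measure_pmf.prob S.D {G. \<not> \<Phi> (Suc t) (S.upd G)} \<le> measure_pmf.prob S.D {G. False}"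
        using 5 val red_empty_absorbing[OF _ S.valid] by (intro mono) (auto simp: \<Phi>_def)
      then show ?thesis using \<epsilon>\<delta> \<delta>0 by simp
    qed
  qed
  have "measure_pmf.prob (graph_history a b N y0 (T + 3)) {Gs. red N (opinions_after N y0 Gs) \<noteq> {}}
    \<le> measure_pmf.prob (graph_history a b N y0 (T + 3)) {Gs. \<not> \<Phi> (T + 3) (opinions_after N y0 Gs)}"
    by (rule measure_pmf.finite_measure_mono) (auto simp: \<Phi>_def)
  also have "\<dots> \<le> real (T + 3) * \<epsilon>"
    by (rule prob_graph_history_chain[OF start step]) (use \<epsilon>\<delta> \<delta>0 in auto)
  finally show ?thesis .
qed

section \<open>Asymptotics\<close>

lemma eventually_exp_neg_ln_le:
  fixes k \<epsilon> :: real
  assumes "0 < k" "0 < \<epsilon>"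
  shows "\<forall>\<^sub>F N in sequentially. exp (- (k * ln (real N))) \<le> \<epsilon>"
proof -
  have "(\<lambda>N. exp (- (k * ln (real N)))) \<longlonglongrightarrow> 0"
    using assms(1) by real_asymp
  then show ?thesis by (rule order_tendstoD(2)[OF _ assms(2), THEN eventually_mono]) simp
qed

lemma square_le_of_smallo_sqrt_ln:
  fixes h :: "nat \<Rightarrow> real"
  assumes h: "h \<in> o(\<lambda>N. sqrt (ln (real N)))" and k: "0 < k"
  shows "\<forall>\<^sub>F N in sequentially. (h N)\<^sup>2 \<le> k * ln (real N)"
proof -
  have "\<forall>\<^sub>F N in sequentially. norm (h N) \<le> sqrt k * norm (sqrt (ln (real N)))"
    by (rule landau_o.smallD[OF h]) (use k in simp)
  moreover have "\<forall>\<^sub>F N :: nat in sequentially. 1 \<le> N" by (rule eventually_ge_at_top)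
  ultimately show ?thesis
  proof eventually_elim
    case (elim N)
    then have "\<bar>h N\<bar>\<^sup>2 \<le> (sqrt k * sqrt (ln (real N)))\<^sup>2"
      by (intro power_mono) auto
    then show ?case using k elim by (simp add: power_mult_distrib)
  qed
qed

text \<open>
  With \<open>u = h\<^sup>2 = L \<eta>\<^sup>2\<close>, a red vertex turns blue with probability at least \<open>r = exp (- (A - 1) u) / 4\<close>. Hence \<open>exp (A u)\<close> rounds exceed the needed
  \<open>4 / (r \<rho>) = (16 / \<rho>) exp ((A - 1) u)\<close> once \<open>exp u \<ge> 16 / \<rho>\<close>, which is where \<open>h \<rightarrow> \<infinity>\<close> enters. All other
  conditions compare \<open>u\<close> with a small multiple of \<open>L\<close>. The exponent \<open>8 \<xi>\<close> of a single vertex is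
  halved by Markov's inequality and halved again to absorb \<open>1 / r\<close> and constants, which leaves \<open>2 \<xi>\<close>
  per round; the number of rounds costs another \<open>\<xi>\<close>.
\<close>

lemma eventually_prob_no_red_ge:
  fixes a b \<xi> :: real and h :: "nat \<Rightarrow> real" and y0 :: "nat \<Rightarrow> opinions"
  defines "A \<equiv> 2 * b * (4 * (a + b) / (a * b))\<^sup>2 + 1"
  assumes ab: "1 < b" "b < a"
    and \<xi>0: "0 < \<xi>" "8 * \<xi> \<le> (a - b)\<^sup>2 / (16 * a)" "8 * \<xi> \<le> b\<^sup>2 / (16 * a)" "8 * \<xi> \<le> b - 1" "8 * \<xi> \<le> 1"
    and h: "filterlim h at_top sequentially" "h \<in> o(\<lambda>N. sqrt (ln (real N)))"
    and valid: "\<forall>N. \<forall>v\<in>{1..N}. y0 N v \<in> {1, - 1}"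
    and adv: "\<forall>\<^sub>F N in sequentially.
      weighted_advantage a b N (y0 N) \<ge> - h N * (real N / sqrt (ln (real N)))"
  shows "\<forall>\<^sub>F N in sequentially.
    measure_pmf.prob (graph_history a b N (y0 N) (nat \<lceil>exp (A * (h N)\<^sup>2)\<rceil> + 3))
      {Gs. red N (opinions_after N (y0 N) Gs) = {}} \<ge> 1 - 2 * real N powr (- \<xi>)"
proof -
  define K where "K = 4 * (a + b) / (a * b)"
  define \<rho> where "\<rho> = b / (2 * (a + b))"
  define A0 where "A0 = 2 * b * K\<^sup>2"
  define \<xi>1 where "\<xi>1 = 8 * \<xi>"
  have K0: "0 < K" and \<rho>0: "0 < \<rho>" using ab by (auto simp: K_def \<rho>_def)
  have A0: "0 < A0" using ab K0 by (simp add: A0_def)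
  have \<xi>1: "0 < \<xi>1" "\<xi>1 \<le> (a - b)\<^sup>2 / (16 * a)" "\<xi>1 \<le> b\<^sup>2 / (16 * a)"
    using \<xi>0 by (auto simp: \<xi>1_def)
  have \<xi>: "0 < \<xi>" "2 * \<xi> \<le> \<xi>1 / 4" "2 * \<xi> \<le> (b - 1) / 4" "2 * \<xi> \<le> 1 / 4"
    using \<xi>0 by (auto simp: \<xi>1_def)
  have A_eq: "A = A0 + 1" by (simp add: A_def A0_def K_def)
  have A: "0 < A" using A0 by (simp add: A_eq)
  have pos: "0 < \<xi>1 / (4 * A0)" "0 < 1 / (8 * A0)" "0 < \<xi> / A" "0 < \<xi>1 / 4" "0 < \<rho> / 16" "0 < (1 / 4 :: real)"
    using \<xi>1(1) A0 \<xi>(1) A \<rho>0 by simp_all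
  \<comment> \<open>A lower bound \<open>M\<close> on \<open>h\<close> ensures that there are enough rounds and that the raised law makes turning
      blue likely; \<open>\<eta>\<^sup>2 \<le> k\<close> is what the smallness conditions on \<open>\<eta>\<close> amount to.\<close>
  define M where "M = max (max 1 (16 / \<rho>)) (4 * (2 * b + a))"
  define k where "k = min (min ((a / 2)\<^sup>2) ((1 / K)\<^sup>2)) (((a - b) / 4)\<^sup>2)"
  have k0: "0 < k" using ab K0 by (simp add: k_def)
  have hM: "\<forall>\<^sub>F N in sequentially. M \<le> h N"
    using h(1) by (simp add: filterlim_at_top)
  have lim7: "(\<lambda>N. (1 + b) / 2 * (1 - exp (- (\<xi>1 / 2 * ln (real N))) - 1 / real N)
      - 2 * b / (b - 1) * a * exp (- (\<xi>1 / 2 * ln (real N)))) \<longlonglongrightarrow> (1 + b) / 2 * (1 - 0 - 0) - 2 * b / (b - 1) * a * 0"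
  proof -
    have d0: "(\<lambda>N. exp (- (\<xi>1 / 2 * ln (real N)))) \<longlonglongrightarrow> 0" using \<xi>1(1) by real_asymp
    have n0: "(\<lambda>N. 1 / real N) \<longlonglongrightarrow> 0" by real_asymp
    show ?thesis by (intro tendsto_diff tendsto_mult tendsto_const d0 n0)
  qed
  have ev7: "\<forall>\<^sub>F N in sequentially. (3 + b) / 4 < (1 + b) / 2 * (1 - exp (- (\<xi>1 / 2 * ln (real N))) - 1 / real N)
      - 2 * b / (b - 1) * a * exp (- (\<xi>1 / 2 * ln (real N)))"
    by (rule order_tendstoD(1)[OF lim7]) (use ab in \<open>simp add: field_simps\<close>)
  have "(\<lambda>N. (4 / \<rho> + 12 * a * ln (real N)) * 16 * exp (- (1 / 2 * ln (real N)))) \<longlonglongrightarrow> 0"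
    using ab by real_asymp
  then have ev8: "\<forall>\<^sub>F N in sequentially. (4 / \<rho> + 12 * a * ln (real N)) * 16 * exp (- (1 / 2 * ln (real N))) < 1 / 2"
    by (rule order_tendstoD) simp
  have "(\<lambda>N. a * ln (real N) / real N) \<longlonglongrightarrow> 0" by real_asymp
  then have ev1: "\<forall>\<^sub>F N in sequentially. a * ln (real N) / real N < 1 / 2"
    by (rule order_tendstoD) simp
  have "(\<lambda>N. a / real N) \<longlonglongrightarrow> 0" by real_asymp
  then have ev2: "\<forall>\<^sub>F N in sequentially. a / real N < (a - b) / 4"
    by (rule order_tendstoD) (use ab in simp)
  have ev0: "\<forall>\<^sub>F N :: nat in sequentially. 2 \<le> N" by (rule eventually_ge_at_top)
  from ev0 ev1 ev2 ev7 ev8 hM adv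
    square_le_of_smallo_sqrt_ln[OF h(2) k0]
    square_le_of_smallo_sqrt_ln[OF h(2) pos(1)]
    square_le_of_smallo_sqrt_ln[OF h(2) pos(2)]
    square_le_of_smallo_sqrt_ln[OF h(2) pos(3)]
    eventually_exp_neg_ln_le[OF pos(4) pos(5)]
    eventually_exp_neg_ln_le[OF pos(4) half_gt_zero[OF zero_less_one]]
    eventually_exp_neg_ln_le[OF \<xi>(1) pos(6)]
  show ?thesis
  proof eventually_elim
    case (elim N)
    define L where "L = ln (real N)"
    define u where "u = (h N)\<^sup>2"
    define \<eta> where "\<eta> = h N / sqrt L"
    define r where "r = exp (- (A0 * u)) / 4"
    define \<delta> where "\<delta> = exp (- (\<xi>1 / 2 * L))"
    define T where "T = nat \<lceil>exp (A * u)\<rceil>"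
    note el = elim[folded L_def u_def]
    have N: "2 \<le> N" "0 < real N" using elim by auto
    have L0: "0 < L" using N by (simp add: L_def)
    have expL: "exp L = real N" using N by (simp add: L_def)
    have hM: "1 \<le> h N" "16 / \<rho> \<le> h N" "4 * (2 * b + a) \<le> h N" using elim by (auto simp: M_def)
    have hu: "h N \<le> u" using hM(1) by (simp add: u_def self_le_power)
    have Lu: "L * \<eta>\<^sup>2 = u" using L0 by (simp add: \<eta>_def u_def power_divide)
    have \<eta>0: "0 \<le> \<eta>" using hM L0 by (simp add: \<eta>_def)
    have \<eta>2: "\<eta>\<^sup>2 \<le> k" using el L0 Lu by (metis mult.commute mult_le_cancel_left_pos)
    have \<eta>le: "\<eta> \<le> x" if "0 \<le> x" "k \<le> x\<^sup>2" for x
      by (rule power2_le_imp_le) (use \<eta>2 that in auto)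
    have \<eta>a: "\<eta> \<le> a / 2" and \<eta>K: "\<eta> \<le> 1 / K" and \<eta>ab: "\<eta> \<le> (a - b) / 4"
      by (rule \<eta>le; use ab K0 in \<open>simp add: k_def\<close>)+
    have u: "A0 * u \<le> \<xi>1 / 4 * L" "A0 * u \<le> 1 / 8 * L" "A * u \<le> \<xi> * L"
      using el A0 A \<xi> \<xi>1 by (auto simp: field_simps)
    have half: "exp (- (u / (4 * (2 * b + a)))) \<le> 1 / 2"
    proof -
      have "1 \<le> u / (4 * (2 * b + a))" using hM(3) hu ab by simp
      then have "2 \<le> exp (u / (4 * (2 * b + a)))"
        using exp_ge_add_one_self[of "u / (4 * (2 * b + a))"] by linarith
      then show ?thesis by (simp add: exp_minus field_simps)
    qed
    have \<delta>r: "\<delta> \<le> r * \<rho> / 4"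
    proof -
      have "\<delta> = exp (- (\<xi>1 / 4 * L)) * exp (- (\<xi>1 / 4 * L))" by (simp add: \<delta>_def flip: exp_add)
      also have "\<dots> \<le> exp (- (A0 * u)) * (\<rho> / 16)"
        using u(1) el \<xi>1 \<rho>0 by (intro mult_mono) auto
      finally show ?thesis by (simp add: r_def)
    qed
    have Tge: "4 / (r * \<rho>) \<le> real T"
    proof -
      have "16 / \<rho> \<le> exp u" using hM(2) hu exp_ge_add_one_self[of u] by linarith
      then have "16 / \<rho> * exp (A0 * u) \<le> exp u * exp (A0 * u)" by (rule mult_right_mono) simp
      also have "\<dots> = exp (A * u)" by (simp add: A_eq algebra_simps flip: exp_add)
      also have "\<dots> \<le> real T" unfolding T_def by linarith
      finally show ?thesis by (simp add: r_def exp_minus field_simps)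
    qed
    have \<epsilon>1: "(4 / \<rho> + 12 * a * L) / (r\<^sup>2 * real N) + \<delta> \<le> exp (- (2 * \<xi> * L))"
    proof -
      have "(4 / \<rho> + 12 * a * L) / (r\<^sup>2 * real N) = (4 / \<rho> + 12 * a * L) * 16 * exp (2 * (A0 * u) - L)"
      proof -
        have "exp (2 * (A0 * u) - L) = (exp (A0 * u))\<^sup>2 / real N"
          unfolding exp_diff expL exp_double ..
        moreover have "r\<^sup>2 = 1 / (16 * (exp (A0 * u))\<^sup>2)"
          by (simp add: r_def exp_minus power_divide field_simps)
        ultimately show ?thesis by simp
      qed
      also have "\<dots> \<le> (4 / \<rho> + 12 * a * L) * 16 * exp (- (1 / 2 * L) - 1 / 4 * L)"
        using u(2) \<rho>0 ab L0 by (intro mult_left_mono) auto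
      also have "\<dots> = (4 / \<rho> + 12 * a * L) * 16 * exp (- (1 / 2 * L)) * exp (- (1 / 4 * L))"
        by (simp only: mult.assoc exp_add[symmetric] add_uminus_conv_diff)
      also have "\<dots> \<le> 1 / 2 * exp (- (1 / 4 * L))"
        using el by (intro mult_right_mono) auto
      also have "\<dots> \<le> 1 / 2 * exp (- (2 * \<xi> * L))"
        using mult_right_mono[OF \<xi>(4), of L] L0 by simp
      finally have 1: "(4 / \<rho> + 12 * a * L) / (r\<^sup>2 * real N) \<le> 1 / 2 * exp (- (2 * \<xi> * L))" .
      have "\<delta> = exp (- (\<xi>1 / 4 * L)) * exp (- (\<xi>1 / 4 * L))" by (simp add: \<delta>_def flip: exp_add)
      also have "\<dots> \<le> 1 / 2 * exp (- (2 * \<xi> * L))"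
        using el \<xi>1 mult_right_mono[OF \<xi>(2), of L] L0 by (intro mult_mono) auto
      finally show ?thesis using 1 by linarith
    qed
    have \<epsilon>2: "exp (- ((b - 1) / 4 * L)) \<le> exp (- (2 * \<xi> * L))"
      using mult_right_mono[OF \<xi>(3), of L] L0 by simp
    have advN: "- \<eta> * real N \<le> weighted_advantage a b N (y0 N)"
      using el by (simp add: \<eta>_def)
    have "measure_pmf.prob (graph_history a b N (y0 N) (T + 3)) {Gs. red N (opinions_after N (y0 N) Gs) \<noteq> {}}
      \<le> real (T + 3) * exp (- (2 * \<xi> * L))"
    proof (rule prob_red_survives_le[where a = a and b = b and N = N and \<xi> = \<xi>1 and \<eta> = \<eta>,
          folded L_def, folded K_def \<rho>_def, folded A0_def, unfolded Lu, folded r_def \<delta>_def])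
      show "1 < b" "b < a" "2 \<le> N" by (fact ab N)+
      show "a * L / real N \<le> 1 / 2" using el by simp
      show "\<xi>1 \<le> (a - b)\<^sup>2 / (16 * a)" "\<xi>1 \<le> b\<^sup>2 / (16 * a)" by (fact \<xi>1)+
      show "0 \<le> \<eta>" "\<eta> \<le> a / 2" by (fact \<eta>0 \<eta>a)+
      show "K * \<eta> \<le> 1" using \<eta>K K0 by (simp add: field_simps)
      have "a / real N < (a - b) / 4" using el by simp
      then show "\<eta> + a / real N \<le> (a - b) / 2" using \<eta>ab by linarith
      show "exp (- (u / (4 * (2 * b + a)))) \<le> 1 / 2" by (fact half)
      show "\<delta> \<le> r * \<rho> / 4" by (fact \<delta>r)
      show "(3 + b) / 4 \<le> (1 + b) / 2 * (1 - \<delta> - 1 / real N) - 2 * b / (b - 1) * a * \<delta>"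
        using el unfolding \<delta>_def by linarith
      show "4 / (r * \<rho>) \<le> real T" by (fact Tge)
      show "(4 / \<rho> + 12 * a * L) / (r\<^sup>2 * real N) + \<delta> \<le> exp (- (2 * \<xi> * L))" by (fact \<epsilon>1)
      show "exp (- ((b - 1) / 4 * L)) \<le> exp (- (2 * \<xi> * L))" by (fact \<epsilon>2)
      show "y0 N v = 1 \<or> y0 N v = - 1" if "v \<in> {1..N}" for v using valid that by blast
      show "- \<eta> * real N \<le> weighted_advantage a b N (y0 N)" by (fact advN)
    qed
    also have "real (T + 3) \<le> 2 * exp (\<xi> * L)"
    proof -
      have "real T \<le> exp (A * u) + 1" unfolding T_def by (simp add: of_nat_nat)
      moreover have "exp (A * u) \<le> exp (\<xi> * L)" using u(3) by simp
      moreover have "4 \<le> exp (\<xi> * L)" using el \<xi>(1) by (simp add: exp_minus field_simps)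
      ultimately show ?thesis unfolding of_nat_add of_nat_numeral by linarith
    qed
    also have "2 * exp (\<xi> * L) * exp (- (2 * \<xi> * L)) = 2 * real N powr (- \<xi>)"
      using N by (simp add: powr_def L_def flip: exp_add)
    finally have "measure_pmf.prob (graph_history a b N (y0 N) (T + 3)) {Gs. red N (opinions_after N (y0 N) Gs) \<noteq> {}}
      \<le> 2 * real N powr (- \<xi>)" by simp
    moreover have "measure_pmf.prob (graph_history a b N (y0 N) (T + 3)) {Gs. red N (opinions_after N (y0 N) Gs) = {}}
      = 1 - measure_pmf.prob (graph_history a b N (y0 N) (T + 3)) {Gs. red N (opinions_after N (y0 N) Gs) \<noteq> {}}"
      using measure_pmf.prob_compl[of "{Gs. red N (opinions_after N (y0 N) Gs) \<noteq> {}}"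
          "graph_history a b N (y0 N) (T + 3)"]
      by (simp add: Compl_eq_Diff_UNIV[symmetric] Collect_neg_eq[symmetric])
    ultimately show ?case unfolding T_def u_def by linarith
  qed
qed

text \<open>
  Since \<open>(1 + h)\<^sup>2 \<le> exp (2 h\<^sup>2)\<close> for \<open>h \<ge> 1\<close> and \<open>6 h\<^sup>2 \<le> L\<close> eventually, the inner exponent is at
  least \<open>N exp (- 3 h\<^sup>2) \<ge> \<surd>N\<close>, so that the first summand is far smaller than any power of \<open>N\<close>.
\<close>

lemma failure_bound_bigo:
  fixes A \<xi> :: real and h :: "nat \<Rightarrow> real"
  assumes A: "0 < A" and \<xi>: "0 < \<xi>"
    and h: "filterlim h at_top sequentially" "h \<in> o(\<lambda>N. sqrt (ln (real N)))"
  defines "f \<equiv> \<lambda>N. 2 * exp (A * (h N)\<^sup>2) * exp (- 1 * real N * (exp (- 1 * (h N)\<^sup>2) / (1 + h N)\<^sup>2))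
      + 4 * exp (- ((ln (real N))\<^sup>2)) + 2 * real N powr (- \<xi>)"
  shows "f \<in> O(\<lambda>N. real N powr (- \<xi>))"
proof (rule bigoI[where c = 8])
  have sixth: "0 < (1 / 6 :: real)" by simp
  have "(\<lambda>N. 2 * \<xi> * ln (real N) / exp (1 / 2 * ln (real N))) \<longlonglongrightarrow> 0" by real_asymp
  then have ev1: "\<forall>\<^sub>F N in sequentially. 2 * \<xi> * ln (real N) / exp (1 / 2 * ln (real N)) < 1"
    by (rule order_tendstoD) simp
  have ev0: "\<forall>\<^sub>F N :: nat in sequentially. 2 \<le> N" by (rule eventually_ge_at_top)
  have h1: "\<forall>\<^sub>F N in sequentially. 1 \<le> h N" using h(1) by (simp add: filterlim_at_top)
  have L\<xi>: "\<forall>\<^sub>F N in sequentially. \<xi> \<le> ln (real N)"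
  proof -
    have "filterlim (\<lambda>N. ln (real N)) at_top sequentially" by real_asymp
    then show ?thesis by (simp add: filterlim_at_top)
  qed
  from ev0 ev1 h1 L\<xi>
    square_le_of_smallo_sqrt_ln[OF h(2), of "\<xi> / A", OF divide_pos_pos[OF \<xi> A]]
    square_le_of_smallo_sqrt_ln[OF h(2), of "1 / 6", OF sixth]
  show "\<forall>\<^sub>F N in sequentially. norm (f N) \<le> 8 * norm (real N powr (- \<xi>))"
  proof eventually_elim
    case (elim N)
    define L where "L = ln (real N)"
    define u where "u = (h N)\<^sup>2"
    note el = elim[folded L_def u_def]
    have N: "2 \<le> N" "0 < real N" using elim by auto
    have expL: "exp L = real N" using N by (simp add: L_def)
    have L0: "0 < L" using N by (simp add: L_def)
    have h1: "1 \<le> h N" using elim by simp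
    have hu: "h N \<le> u" using h1 by (simp add: u_def self_le_power)
    have Np: "real N powr (- \<xi>) = exp (- (\<xi> * L))" using N by (simp add: powr_def L_def)
    have "exp (L / 2) \<le> real N * (exp (- 1 * u) / (1 + h N)\<^sup>2)"
    proof -
      have "(1 + h N)\<^sup>2 \<le> (exp (h N))\<^sup>2" using h1 exp_ge_add_one_self[of "h N"] by (intro power_mono) auto
      also have "\<dots> = exp (2 * h N)" by (simp add: exp_double)
      also have "\<dots> \<le> exp (2 * u)" using hu by simp
      finally have sq: "(1 + h N)\<^sup>2 \<le> exp (2 * u)" .
      have "exp (L / 2) \<le> exp (L - u - 2 * u)" using el by simp
      also have "\<dots> = real N * (exp (- 1 * u) / exp (2 * u))" by (simp flip: expL exp_diff exp_add)
      also have "\<dots> \<le> real N * (exp (- 1 * u) / (1 + h N)\<^sup>2)"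
        using sq h1 by (intro mult_left_mono divide_left_mono) auto
      finally show ?thesis .
    qed
    moreover have "A * u + \<xi> * L \<le> exp (L / 2)"
    proof -
      have "A * u \<le> \<xi> * L" using el A \<xi> by (auto simp: field_simps)
      moreover have "2 * \<xi> * L < exp (L / 2)" using el by (simp add: field_simps)
      ultimately show ?thesis by simp
    qed
    ultimately have "A * u - real N * (exp (- 1 * u) / (1 + h N)\<^sup>2) \<le> - (\<xi> * L)" by linarith
    then have 1: "exp (A * u) * exp (- 1 * real N * (exp (- 1 * u) / (1 + h N)\<^sup>2)) \<le> exp (- (\<xi> * L))"
      by (simp flip: exp_add)
    have 2: "exp (- (L\<^sup>2)) \<le> exp (- (\<xi> * L))"
      using el L0 by (simp add: power2_eq_square)
    have eq: "f N = 2 * (exp (A * u) * exp (- 1 * real N * (exp (- 1 * u) / (1 + h N)\<^sup>2)))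
        + 4 * exp (- (L\<^sup>2)) + 2 * exp (- (\<xi> * L))"
      by (simp add: f_def Np u_def L_def)
    have "0 \<le> f N" unfolding eq by (intro add_nonneg_nonneg) auto
    moreover have "f N \<le> 8 * exp (- (\<xi> * L))" unfolding eq using 1 2 by linarith
    ultimately show ?case by (simp add: Np)
  qed
qed

theorem theorem1p7:
  fixes a b :: real
  assumes "a > b" and "b > 1"
  shows "\<exists>A>0. \<exists>c>0. \<exists>C>0. \<exists>\<xi>>0. \<forall>h :: nat \<Rightarrow> real.
    filterlim h at_top sequentially \<longrightarrow>
    h \<in> o(\<lambda>N. sqrt (ln (real N))) \<longrightarrow>
    (let rhs = (\<lambda>N :: nat. 1
           - 2 * exp (A * (h N)\<^sup>2) * exp (- c * real N * (exp (- C * (h N)\<^sup>2) / (1 + h N)\<^sup>2))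
           - 4 * exp (- ((ln (real N))\<^sup>2))
           - 2 * real N powr (- \<xi>))
     in (\<forall>y0 :: nat \<Rightarrow> opinions.
           (\<forall>N. \<forall>v\<in>{1..N}. y0 N v \<in> {1, - 1}) \<longrightarrow>
           (\<forall>\<^sub>F N in sequentially.
              weighted_advantage a b N (y0 N) \<ge> - h N * (real N / sqrt (ln (real N)))) \<longrightarrow>
           (\<forall>\<^sub>F N in sequentially.
              measure_pmf.prob (graph_history a b N (y0 N) (nat \<lceil>exp (A * (h N)\<^sup>2)\<rceil> + 3))
                {Gs. red N (opinions_after N (y0 N) Gs) = {}} \<ge> rhs N))
      \<and> (\<exists>\<epsilon> :: nat \<Rightarrow> real. \<epsilon> \<longlonglongrightarrow> 0 \<and>
           (\<lambda>N. 1 - rhs N) \<in> O(\<lambda>N. real N powr (- \<xi> + \<epsilon> N))))"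
proof -
  define A where "A = 2 * b * (4 * (a + b) / (a * b))\<^sup>2 + 1"
  define \<xi> where "\<xi> = min (min ((a - b)\<^sup>2 / (16 * a)) (b\<^sup>2 / (16 * a))) (min (b - 1) 1) / 8"
  have A: "0 < A" using assms by (simp add: A_def add_nonneg_pos)
  have \<xi>: "0 < \<xi>" using assms by (simp add: \<xi>_def)
  have \<xi>_le: "8 * \<xi> \<le> (a - b)\<^sup>2 / (16 * a)" "8 * \<xi> \<le> b\<^sup>2 / (16 * a)" "8 * \<xi> \<le> b - 1" "8 * \<xi> \<le> 1"
    by (simp_all add: \<xi>_def)
  define rhs where "rhs h N = 1
           - 2 * exp (A * (h N)\<^sup>2) * exp (- 1 * real N * (exp (- 1 * (h N)\<^sup>2) / (1 + h N)\<^sup>2))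
           - 4 * exp (- ((ln (real N))\<^sup>2))
           - 2 * real N powr (- \<xi>)" for h :: "nat \<Rightarrow> real" and N :: nat
  have rhs_le: "rhs h N \<le> 1 - 2 * real N powr (- \<xi>)" for h N
  proof -
    have "1 - 2 * exp x * exp y - 4 * exp z - w \<le> 1 - w" for x y z w :: real
      using mult_pos_pos[OF exp_gt_zero[of x] exp_gt_zero[of y]] exp_gt_zero[of z] by linarith
    then show ?thesis unfolding rhs_def .
  qed
  have prob: "\<forall>\<^sub>F N in sequentially.
      measure_pmf.prob (graph_history a b N (y0 N) (nat \<lceil>exp (A * (h N)\<^sup>2)\<rceil> + 3))
        {Gs. red N (opinions_after N (y0 N) Gs) = {}} \<ge> rhs h N"
    if h: "filterlim h at_top sequentially" "h \<in> o(\<lambda>N. sqrt (ln (real N)))"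
      and y0: "\<forall>N. \<forall>v\<in>{1..N}. y0 N v \<in> {1, - 1}"
        "\<forall>\<^sub>F N in sequentially. weighted_advantage a b N (y0 N) \<ge> - h N * (real N / sqrt (ln (real N)))"
    for h :: "nat \<Rightarrow> real" and y0 :: "nat \<Rightarrow> opinions"
    using eventually_prob_no_red_ge[OF assms(2,1) \<xi> \<xi>_le h y0, folded A_def]
    by (rule eventually_mono) (use rhs_le in \<open>auto intro: order.trans\<close>)
  have bigo: "\<exists>\<epsilon> :: nat \<Rightarrow> real. \<epsilon> \<longlonglongrightarrow> 0 \<and> (\<lambda>N. 1 - rhs h N) \<in> O(\<lambda>N. real N powr (- \<xi> + \<epsilon> N))"
    if h: "filterlim h at_top sequentially" "h \<in> o(\<lambda>N. sqrt (ln (real N)))" for h :: "nat \<Rightarrow> real"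
  proof (rule exI[of _ "\<lambda>_. 0"], rule conjI[OF tendsto_const])
    have "1 - (1 - x - y - z) = x + y + z" for x y z :: real by simp
    then show "(\<lambda>N. 1 - rhs h N) \<in> O(\<lambda>N. real N powr (- \<xi> + 0))"
      using failure_bound_bigo[OF A \<xi> h] unfolding rhs_def add_0_right by (simp only:)
  qed
  \<comment> \<open>The term with \<open>c\<close> and \<open>C\<close> only lowers \<open>rhs\<close>, and with \<open>c = C = 1\<close> it is small enough for the
      asymptotic claim, with \<open>\<epsilon> = 0\<close>.\<close>
  show ?thesis
  proof (rule exI[of _ A], rule conjI[OF A], rule exI[of _ 1], rule conjI[OF zero_less_one],
      rule exI[of _ 1], rule conjI[OF zero_less_one], rule exI[of _ \<xi>], rule conjI[OF \<xi>], intro allI impI)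
    fix h :: "nat \<Rightarrow> real"
    assume h: "filterlim h at_top sequentially" "h \<in> o(\<lambda>N. sqrt (ln (real N)))"
    show "let rhs = (\<lambda>N :: nat. 1
           - 2 * exp (A * (h N)\<^sup>2) * exp (- 1 * real N * (exp (- 1 * (h N)\<^sup>2) / (1 + h N)\<^sup>2))
           - 4 * exp (- ((ln (real N))\<^sup>2))
           - 2 * real N powr (- \<xi>))
     in (\<forall>y0 :: nat \<Rightarrow> opinions.
           (\<forall>N. \<forall>v\<in>{1..N}. y0 N v \<in> {1, - 1}) \<longrightarrow>
           (\<forall>\<^sub>F N in sequentially.
              weighted_advantage a b N (y0 N) \<ge> - h N * (real N / sqrt (ln (real N)))) \<longrightarrow>
           (\<forall>\<^sub>F N in sequentially.
              measure_pmf.prob (graph_history a b N (y0 N) (nat \<lceil>exp (A * (h N)\<^sup>2)\<rceil> + 3))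
                {Gs. red N (opinions_after N (y0 N) Gs) = {}} \<ge> rhs N))
      \<and> (\<exists>\<epsilon> :: nat \<Rightarrow> real. \<epsilon> \<longlonglongrightarrow> 0 \<and>
           (\<lambda>N. 1 - rhs N) \<in> O(\<lambda>N. real N powr (- \<xi> + \<epsilon> N)))"
      unfolding Let_def rhs_def[symmetric] using prob[OF h] bigo[OF h] by blast
  qed
qed

end
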